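(* For the odd-cycle Gaussian problem with $0<D\le1$, the rate-distortion function is $R^{IG}(D)=\frac m4\log\frac1D$.
   Context: Odd-cycle Gaussian problem: $m\ge5$ odd; source $\mathbf{X}=(X_1,\dots,X_m)$ with independent $N(0,1)$ components, i.i.d. over time; decoder $i\in[m]$ has side information $\mathbf{Y_i}=(X_{i-1},X_{i+1})$ (indices mod $m$, taken in $[m]$) and must reconstruct $X_i$ with mean squared error $\frac1n\sum_{k=1}^nE[(X_{ik}-\widehat X_{ik})^2]\le D$. A code is an encoder of $\mathbf{X}^n$ into $\{1,\dots,M\}$ and decoders mapping (message, $\mathbf{Y_i}^n$) to $\widehat X_i^n$; $R$ is achievable if for every $\epsilon>0$ and all large $n$ there is a code with $\frac1n\log M\le R+\epsilon$ meeting distortion $D+\epsilon$ at every decoder; $R^{IG}(D)$ is the infimum of achievable rates (logarithms in the same base as the rate). *)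

theory Defs
  imports "HOL-Probability.Probability"
begin

text \<open>Components are indexed by i in {0..<m} (cyclically), time instants by k in {0..<n}.
  A source block x is a function on {0..<n} x {0..<m}; x (k,i) is X_i at time k.\<close>

definition std_normal :: "real measure" where
  "std_normal = density lborel std_normal_density"

definition src :: "nat \<Rightarrow> nat \<Rightarrow> (nat \<times> nat \<Rightarrow> real) measure" where
  "src m n = PiM ({..<n} \<times> {..<m}) (\<lambda>_. std_normal)"

definition side :: "nat \<Rightarrow> nat \<Rightarrow> nat \<Rightarrow> (nat \<times> nat) set" where
  "side m i n = {..<n} \<times> {(i + m - 1) mod m, (i + 1) mod m}"

definition is_code :: "nat \<Rightarrow> nat \<Rightarrow> nat \<Rightarrow> real \<Rightarrow> bool" where
  "is_code m n M d \<longleftrightarrow>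
    (\<exists>(f :: (nat \<times> nat \<Rightarrow> real) \<Rightarrow> nat)
      (g :: nat \<Rightarrow> nat \<Rightarrow> (nat \<times> nat \<Rightarrow> real) \<Rightarrow> nat \<Rightarrow> real).
      f \<in> measurable (src m n) (count_space UNIV) \<and>
      (\<forall>x \<in> space (src m n). f x \<in> {1..M}) \<and>
      (\<forall>i<m. \<forall>w. \<forall>k<n.
         (\<lambda>y. g i w y k) \<in> borel_measurable (PiM (side m i n) (\<lambda>_. lborel))) \<and>
      (\<forall>i<m. ennreal (1 / real n) *
          (\<Sum>k<n. \<integral>\<^sup>+ x. ennreal ((x (k, i) - g i (f x) (restrict x (side m i n)) k)\<^sup>2) \<partial>src m n)
        \<le> ennreal d))"

definition achievable :: "nat \<Rightarrow> real \<Rightarrow> real \<Rightarrow> bool" where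
  "achievable m D R \<longleftrightarrow>
    (\<forall>\<epsilon>>0. \<exists>N. \<forall>n\<ge>N. \<exists>M::nat. M \<ge> 1 \<and> ln (real M) / real n \<le> R + \<epsilon> \<and> is_code m n M (D + \<epsilon>))"

definition R_IG :: "nat \<Rightarrow> real \<Rightarrow> real" where
  "R_IG m D = Inf {R. achievable m D R}"

end

theory Submission
  imports Defs "HOL-Real_Asymp.Real_Asymp"
begin

text \<open>
  Write \<open>h(S)\<close> for the conditional entropy of the message given the source components in \<open>S\<close>. Since the
  components are independent, \<open>h\<close> is submodular and decreasing, and if \<open>S\<close> contains both neighbours of
  \<open>i \<notin> S\<close>, then decoder \<open>i\<close> forces \<open>h(S) - h(S \<union> {i}) \<ge> n/2 log(1/D)\<close>. Let \<open>m = 2r + 3\<close>. Starting from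
  the even vertices below \<open>2r + 1\<close> and from the odd vertices below \<open>2r + 2\<close>, \<open>r\<close> such gains each lead to the
  paths \<open>{0..2r}\<close> and \<open>{1..2r+1}\<close>. Submodularity trades these for \<open>{0..2r+1}\<close>, which still gains vertex
  \<open>2r + 2\<close>, and \<open>{1..2r}\<close>, which after adding \<open>2r + 2\<close> still gains \<open>0\<close> and \<open>2r + 1\<close>. Altogether
  \<open>2 log M \<ge> m n/2 log(1/D)\<close>.

  Conversely, quantize the two halves of each component separately, obtaining indices \<open>a\<^sub>i, b\<^sub>i\<close> modulo \<open>N\<close> with
  \<open>log N\<close> about \<open>n/4 log(1/D)\<close>, and send \<open>b\<^sub>i + a\<^bsub>i+1\<^esub> mod N\<close> for every edge of the cycle. Decoder \<open>i\<close> knows both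
  neighbouring components and hence recovers \<open>a\<^sub>i\<close> from the edge \<open>(i-1, i)\<close> and \<open>b\<^sub>i\<close> from the edge \<open>(i, i+1)\<close>.
\<close>

section \<open>Conditional entropy of a message about a product source\<close>

text \<open>Only an inequality, because for \<open>p = 0\<close> the quotient is 0. It lets
  posteriors that vanish be cancelled without a case distinction.\<close>

lemma ennreal_mult_divide_self_le: "0 \<le> p \<Longrightarrow> 0 \<le> a \<Longrightarrow> ennreal p * ennreal (a / p) \<le> ennreal a"
  by (cases "p = 0") (auto simp: ennreal_mult''[symmetric])

text \<open>Jensen's inequality via ln u \<le> u - 1. Each upper bound on entropies below comes from
  a ratio \<open>u\<close> of posteriors whose expected logarithm is the entropy difference in
  question.\<close>

lemma (in prob_space) expectation_ln_nonpos:
  fixes u :: "'a \<Rightarrow> real"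
  assumes [measurable]: "u \<in> borel_measurable M"
    and pos: "AE x in M. 0 < u x" and le1: "(\<integral>\<^sup>+x. ennreal (u x) \<partial>M) \<le> 1"
    and int: "integrable M (\<lambda>x. ln (u x))"
  shows "expectation (\<lambda>x. ln (u x)) \<le> 0"
proof -
  have nn: "AE x in M. 0 \<le> u x"
    using pos by eventually_elim simp
  have iu: "integrable M u"
    using le1 nn by (intro integrableI_nonneg) (auto intro: le_less_trans)
  have "ennreal (expectation u) \<le> 1"
    using le1 nn_integral_eq_integral[OF iu nn] by simp
  then have u1: "expectation u \<le> 1"
    by simp
  have "expectation (\<lambda>x. ln (u x)) \<le> expectation (\<lambda>x. u x - 1)"
    using pos by (intro integral_mono_AE int) (auto intro!: iu ln_le_minus_one elim!: eventually_mono)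
  also have "\<dots> \<le> 0"
    using u1 iu by (simp add: prob_space)
  finally show ?thesis .
qed

section \<open>Conditioning in a product space by resampling coordinates\<close>

context finite_product_prob_space
begin

text \<open>Integrating \<open>h (resample A x y)\<close> over \<open>y\<close> is the conditional
  expectation of \<open>h\<close> given the coordinates in \<open>A\<close>, by independence. This
  pointwise version avoids null sets and sub-sigma-algebras.\<close>

definition resample :: "'a set \<Rightarrow> ('a \<Rightarrow> 'b) \<Rightarrow> ('a \<Rightarrow> 'b) \<Rightarrow> ('a \<Rightarrow> 'b)" where
  "resample A x y = (\<lambda>c\<in>I. if c \<in> A then x c else y c)"

abbreviation P :: "('a \<Rightarrow> 'b) measure" where
  "P \<equiv> Pi\<^sub>M I M"

text \<open>Pointwise substitute for measurability with respect to the coordinates in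
  \<open>A\<close>.\<close>

definition depends_on :: "'a set \<Rightarrow> (('a \<Rightarrow> 'b) \<Rightarrow> 'c) \<Rightarrow> bool" where
  "depends_on A k \<longleftrightarrow> (\<forall>x\<in>space P. \<forall>y\<in>space P. k (resample A x y) = k x)"

lemma measurable_resample [measurable]:
  assumes [measurable]: "f \<in> N \<rightarrow>\<^sub>M P" "g \<in> N \<rightarrow>\<^sub>M P"
  shows "(\<lambda>z. resample A (f z) (g z)) \<in> N \<rightarrow>\<^sub>M P"
  unfolding resample_def
proof (intro measurable_restrict)
  fix i assume i [measurable]: "i \<in> I"
  show "(\<lambda>x. if i \<in> A then f x i else g x i) \<in> N \<rightarrow>\<^sub>M M i"
    by (cases "i \<in> A") (auto intro!: measurable_compose[OF _ measurable_component_singleton[OF i]] assms)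
qed

lemma resample_in_space [simp]:
  "x \<in> space P \<Longrightarrow> y \<in> space P \<Longrightarrow> resample A x y \<in> space P"
  unfolding resample_def space_PiM by (auto simp: PiE_iff)

lemma resample_resample:
  "resample A (resample B x y) z = resample (A \<inter> B) x (resample A y z)"
  unfolding resample_def by (auto simp: fun_eq_iff)

text \<open>It suffices to compare boxes. The preimage of a box is a product of two boxes that share
  out its constraints: \<open>B1\<close> keeps those inside \<open>A\<close>, \<open>B2\<close> the
  others, so each coordinate contributes its own factor times 1.\<close>

lemma distr_resample: "distr (P \<Otimes>\<^sub>M P) P (\<lambda>(x, y). resample A x y) = P"
proof (rule PiM_eqI)
  fix B assume B: "\<And>i. i \<in> I \<Longrightarrow> B i \<in> sets (M i)"
  define B1 where "B1 i = (if i \<in> A then B i else space (M i))" for i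
  define B2 where "B2 i = (if i \<in> A then space (M i) else B i)" for i
  have [measurable]: "B1 i \<in> sets (M i)" "B2 i \<in> sets (M i)" if "i \<in> I" for i
    using B[OF that] by (auto simp: B1_def B2_def)
  have sub: "B i \<subseteq> space (M i)" if "i \<in> I" for i
    using B[OF that] by (rule sets.sets_into_space)
  have eq: "(\<lambda>(x, y). resample A x y) -` (Pi\<^sub>E I B) \<inter> space (P \<Otimes>\<^sub>M P) = Pi\<^sub>E I B1 \<times> Pi\<^sub>E I B2"
  proof (intro set_eqI)
    fix z :: "('a \<Rightarrow> 'b) \<times> ('a \<Rightarrow> 'b)"
    obtain x y where z: "z = (x, y)" by (cases z)
    have "z \<in> (\<lambda>(x, y). resample A x y) -` (Pi\<^sub>E I B) \<inter> space (P \<Otimes>\<^sub>M P) \<longleftrightarrow>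
        (\<forall>i\<in>I. (if i \<in> A then x i else y i) \<in> B i \<and> x i \<in> space (M i) \<and> y i \<in> space (M i))
          \<and> x \<in> extensional I \<and> y \<in> extensional I"
      by (auto simp: z resample_def space_pair_measure space_PiM PiE_iff)
    also have "\<dots> \<longleftrightarrow> (\<forall>i\<in>I. x i \<in> B1 i \<and> y i \<in> B2 i) \<and> x \<in> extensional I \<and> y \<in> extensional I"
    proof -
      have "((if i \<in> A then x i else y i) \<in> B i \<and> x i \<in> space (M i) \<and> y i \<in> space (M i))
         = (x i \<in> B1 i \<and> y i \<in> B2 i)" if "i \<in> I" for i
        using sub[OF that] by (cases "i \<in> A") (auto simp: B1_def B2_def)
      then show ?thesis by (simp cong: ball_cong)
    qed
    also have "\<dots> \<longleftrightarrow> z \<in> Pi\<^sub>E I B1 \<times> Pi\<^sub>E I B2"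
      by (auto simp: z PiE_iff)
    finally show "z \<in> (\<lambda>(x, y). resample A x y) -` (Pi\<^sub>E I B) \<inter> space (P \<Otimes>\<^sub>M P) \<longleftrightarrow> z \<in> Pi\<^sub>E I B1 \<times> Pi\<^sub>E I B2" .
  qed
  have "emeasure (distr (P \<Otimes>\<^sub>M P) P (\<lambda>(x, y). resample A x y)) (Pi\<^sub>E I B) = emeasure (P \<Otimes>\<^sub>M P) (Pi\<^sub>E I B1 \<times> Pi\<^sub>E I B2)"
    using B by (subst emeasure_distr) (auto simp: eq finite_index intro!: sets_PiM_I_finite)
  also have "\<dots> = emeasure P (Pi\<^sub>E I B1) * emeasure P (Pi\<^sub>E I B2)"
    by (intro emeasure_pair_measure_Times sets_PiM_I_finite finite_index) auto
  also have "\<dots> = (\<Prod>i\<in>I. emeasure (M i) (B1 i) * emeasure (M i) (B2 i))"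
    by (simp add: measure_times prod.distrib)
  also have "\<dots> = (\<Prod>i\<in>I. emeasure (M i) (B i))"
    by (intro prod.cong) (auto simp: B1_def B2_def M.emeasure_space_1)
  finally show "emeasure (distr (P \<Otimes>\<^sub>M P) P (\<lambda>(x, y). resample A x y)) (Pi\<^sub>E I B) = (\<Prod>i\<in>I. emeasure (M i) (B i))" .
qed (auto simp: finite_index)

lemma nn_integral_resample:
  assumes [measurable]: "h \<in> borel_measurable P"
  shows "(\<integral>\<^sup>+x. \<integral>\<^sup>+y. h (resample A x y) \<partial>P \<partial>P) = (\<integral>\<^sup>+x. h x \<partial>P)"
proof -
  have "(\<integral>\<^sup>+x. h x \<partial>P) = (\<integral>\<^sup>+x. h x \<partial>distr (P \<Otimes>\<^sub>M P) P (\<lambda>(x, y). resample A x y))"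
    by (simp add: distr_resample)
  also have "\<dots> = (\<integral>\<^sup>+z. h (resample A (fst z) (snd z)) \<partial>(P \<Otimes>\<^sub>M P))"
    by (subst nn_integral_distr) (auto simp: case_prod_beta)
  also have "\<dots> = (\<integral>\<^sup>+x. \<integral>\<^sup>+y. h (resample A x y) \<partial>P \<partial>P)"
    by (subst nn_integral_fst[symmetric]) auto
  finally show ?thesis by simp
qed

text \<open>Tower property: a factor known from the coordinates in \<open>A\<close> is unaffected by
  resampling and leaves the inner integral.\<close>

lemma nn_integral_tower:
  assumes [measurable]: "h \<in> borel_measurable P" "k \<in> borel_measurable P" and k: "depends_on A k"
  shows "(\<integral>\<^sup>+x. h x * k x \<partial>P) = (\<integral>\<^sup>+x. (\<integral>\<^sup>+y. h (resample A x y) \<partial>P) * k x \<partial>P)"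
proof -
  have "(\<integral>\<^sup>+x. h x * k x \<partial>P) = (\<integral>\<^sup>+x. \<integral>\<^sup>+y. h (resample A x y) * k (resample A x y) \<partial>P \<partial>P)"
    by (rule nn_integral_resample[symmetric]) auto
  also have "\<dots> = (\<integral>\<^sup>+x. \<integral>\<^sup>+y. h (resample A x y) * k x \<partial>P \<partial>P)"
    using k by (intro nn_integral_cong) (auto simp: depends_on_def)
  also have "\<dots> = (\<integral>\<^sup>+x. (\<integral>\<^sup>+y. h (resample A x y) \<partial>P) * k x \<partial>P)"
    by (intro nn_integral_cong nn_integral_multc) auto
  finally show ?thesis .
qed

lemma depends_on_mono:
  assumes "depends_on A k" "A \<subseteq> B"
  shows "depends_on B k"
  unfolding depends_on_def
proof (intro ballI)
  fix x y assume xy: "x \<in> space P" "y \<in> space P"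
  have "k (resample B x y) = k (resample A (resample B x y) x)"
    using assms(1) xy unfolding depends_on_def by (metis resample_in_space)
  also have "resample A (resample B x y) x = resample A x x"
    using assms(2) unfolding resample_def by (auto simp: fun_eq_iff)
  also have "k \<dots> = k x"
    using assms(1) xy unfolding depends_on_def by blast
  finally show "k (resample B x y) = k x" .
qed

end

section \<open>Posteriors and conditional entropy of the message\<close>

locale product_message = finite_product_prob_space M I for M :: "'i \<Rightarrow> 'a measure" and I +
  fixes F :: "('i \<Rightarrow> 'a) \<Rightarrow> nat" and W :: "nat set"
  assumes F_measurable [measurable]: "F \<in> P \<rightarrow>\<^sub>M count_space UNIV"
    and finite_W: "finite W" and F_in_W: "\<And>x. x \<in> space P \<Longrightarrow> F x \<in> W"
begin

text \<open>By independence of the coordinates, \<open>post A w x\<close> is the conditional probability of the message \<open>w\<close> given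
  the coordinates of \<open>x\<close> in \<open>A\<close>, so \<open>cond_entropy\<close> below is an honest conditional entropy.\<close>

definition post :: "'i set \<Rightarrow> nat \<Rightarrow> ('i \<Rightarrow> 'a) \<Rightarrow> real" where
  "post A w x = prob {y \<in> space P. F (resample A x y) = w}"

text \<open>The posterior of the message actually sent; its negative logarithm is the information
  density averaged in \<open>cond_entropy\<close>.\<close>

definition lik :: "'i set \<Rightarrow> ('i \<Rightarrow> 'a) \<Rightarrow> real" where
  "lik A x = post A (F x) x"

lemma post_eq: "x \<in> space P \<Longrightarrow> ennreal (post A w x) = (\<integral>\<^sup>+y. (if F (resample A x y) = w then 1 else 0) \<partial>P)"
proof -
  assume [measurable]: "x \<in> space P"
  have "(\<integral>\<^sup>+y. (if F (resample A x y) = w then 1 else 0) \<partial>P) = (\<integral>\<^sup>+y. indicator {y \<in> space P. F (resample A x y) = w} y \<partial>P)"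
    by (intro nn_integral_cong) (auto simp: indicator_def)
  also have "\<dots> = emeasure P {y \<in> space P. F (resample A x y) = w}"
    by (intro nn_integral_indicator) measurable
  finally show ?thesis
    by (simp add: post_def emeasure_eq_measure)
qed

lemma post_nonneg [simp]: "0 \<le> post A w x" and post_le_1 [simp]: "post A w x \<le> 1"
  by (auto simp: post_def)

lemma measurable_post [measurable]: "post A w \<in> borel_measurable P"
proof -
  have "(\<lambda>x. enn2real (\<integral>\<^sup>+y. (if F (resample A x y) = w then 1 else 0) \<partial>P)) \<in> borel_measurable P"
    by measurable
  also have "?this \<longleftrightarrow> ?thesis"
    by (intro measurable_cong) (simp add: post_eq[symmetric])
  finally show ?thesis .
qed

lemma measurable_lik [measurable]: "lik A \<in> borel_measurable P"
  unfolding lik_def by (rule measurable_compose_countable'[where I=UNIV]) auto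

lemma lik_nonneg [simp]: "0 \<le> lik A x" and lik_le_1 [simp]: "lik A x \<le> 1"
  by (auto simp: lik_def)

lemma depends_on_post: "depends_on A (post A w)"
  unfolding depends_on_def post_def
proof (intro ballI arg_cong[where f=prob] Collect_cong conj_cong refl)
  fix x y z
  show "(F (resample A (resample A x y) z) = w) = (F (resample A x z) = w)"
    by (rule arg_cong[where f="\<lambda>x. F x = w"]) (auto simp: resample_def fun_eq_iff)
qed

text \<open>The coordinates of \<open>x\<close> that survive both resamplings are those in
  \<open>A \<inter> B\<close>; all others are fresh and integrate out. Submodularity gets its use of
  independence from here.\<close>

lemma post_split:
  assumes x: "x \<in> space P"
  shows "(\<integral>\<^sup>+y. ennreal (post B w (resample A x y)) \<partial>P) = ennreal (post (A \<inter> B) w x)"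
proof -
  have "(\<integral>\<^sup>+y. ennreal (post B w (resample A x y)) \<partial>P)
     = (\<integral>\<^sup>+y. \<integral>\<^sup>+z. (if F (resample (A \<inter> B) x (resample B y z)) = w then 1 else 0) \<partial>P \<partial>P)"
    using x by (intro nn_integral_cong) (simp add: post_eq resample_resample Int_commute)
  also have "\<dots> = (\<integral>\<^sup>+y. (if F (resample (A \<inter> B) x y) = w then 1 else 0) \<partial>P)"
    using x by (intro nn_integral_resample) measurable
  finally show ?thesis using x by (simp add: post_eq)
qed

lemma sum_post: "(\<Sum>w\<in>W. \<integral>\<^sup>+x. ennreal (post A w x) \<partial>P) = 1"
proof -
  have "(\<Sum>w\<in>W. \<integral>\<^sup>+x. ennreal (post A w x) \<partial>P) = (\<Sum>w\<in>W. \<integral>\<^sup>+x. \<integral>\<^sup>+y. (if F (resample A x y) = w then 1 else 0) \<partial>P \<partial>P)"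
    by (intro sum.cong nn_integral_cong) (auto simp: post_eq)
  also have "\<dots> = (\<Sum>w\<in>W. \<integral>\<^sup>+x. (if F x = w then 1 else 0) \<partial>P)"
    by (intro sum.cong nn_integral_resample) auto
  also have "\<dots> = (\<integral>\<^sup>+x. (\<Sum>w\<in>W. (if F x = w then 1 else 0 :: ennreal)) \<partial>P)"
    by (subst nn_integral_sum) auto
  also have "\<dots> = (\<integral>\<^sup>+x. 1 \<partial>P)"
    using F_in_W finite_W by (intro nn_integral_cong) (auto simp: indicator_def)
  finally show ?thesis by (simp add: emeasure_space_1)
qed

text \<open>Splitting by the value of the message and conditioning on \<open>A\<close> turns the
  random index \<open>F x\<close> into a sum with posterior weights. These weights then cancel
  denominators in the entropy proofs.\<close>

lemma nn_integral_message:
  assumes [measurable]: "\<And>w. k w \<in> borel_measurable P" and k: "\<And>w. w \<in> W \<Longrightarrow> depends_on A (k w)"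
  shows "(\<integral>\<^sup>+x. k (F x) x \<partial>P) = (\<Sum>w\<in>W. \<integral>\<^sup>+x. ennreal (post A w x) * k w x \<partial>P)"
proof -
  have "(\<integral>\<^sup>+x. k (F x) x \<partial>P) = (\<integral>\<^sup>+x. (\<Sum>w\<in>W. (if F x = w then 1 else 0) * k w x) \<partial>P)"
  proof (intro nn_integral_cong)
    fix x assume "x \<in> space P"
    then have "F x \<in> W" by (rule F_in_W)
    then show "k (F x) x = (\<Sum>w\<in>W. (if F x = w then 1 else 0) * k w x)"
      using finite_W by (simp add: if_distrib[of "\<lambda>c. c * _"] cong: if_cong)
  qed
  also have "\<dots> = (\<Sum>w\<in>W. \<integral>\<^sup>+x. (if F x = w then 1 else 0) * k w x \<partial>P)"
    by (subst nn_integral_sum) auto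
  also have "\<dots> = (\<Sum>w\<in>W. \<integral>\<^sup>+x. (\<integral>\<^sup>+y. (if F (resample A x y) = w then 1 else 0) \<partial>P) * k w x \<partial>P)"
    using k by (intro sum.cong nn_integral_tower) auto
  also have "\<dots> = (\<Sum>w\<in>W. \<integral>\<^sup>+x. ennreal (post A w x) * k w x \<partial>P)"
    by (intro sum.cong nn_integral_cong) (auto simp: post_eq)
  finally show ?thesis .
qed

text \<open>A message is sent with its posterior probability, so the event that it has posterior 0
  carries no mass.\<close>

lemma AE_lik_pos: "AE x in P. 0 < lik A x"
proof -
  have "(\<integral>\<^sup>+x. indicator {0} (lik A x) \<partial>P) = (\<Sum>w\<in>W. \<integral>\<^sup>+x. ennreal (post A w x) * indicator {0} (post A w x) \<partial>P)"
    unfolding lik_def using depends_on_post by (intro nn_integral_message) (auto simp: depends_on_def)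
  also have "\<dots> = (\<Sum>w\<in>W. \<integral>\<^sup>+x. 0 \<partial>P)"
    by (intro sum.cong nn_integral_cong) (auto simp: indicator_def)
  finally have "(\<integral>\<^sup>+x. indicator {0} (lik A x) \<partial>P) = 0" by simp
  then have "AE x in P. indicator {0} (lik A x) = (0::ennreal)"
    by (subst (asm) nn_integral_0_iff_AE) auto
  then show ?thesis
    by eventually_elim (auto simp: indicator_def less_le split: if_splits)
qed

text \<open>The weight \<open>post A w x\<close> cancels the reciprocal, so each message contributes
  at most 1. This yields both integrability of \<open>ln (lik A x)\<close> and the bound of the
  entropy by the log-cardinality.\<close>

lemma nn_integral_inverse_lik: "(\<integral>\<^sup>+x. ennreal (1 / lik A x) \<partial>P) \<le> ennreal (card W)"
proof -
  have "(\<integral>\<^sup>+x. ennreal (1 / lik A x) \<partial>P) = (\<Sum>w\<in>W. \<integral>\<^sup>+x. ennreal (post A w x) * ennreal (1 / post A w x) \<partial>P)"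
    unfolding lik_def using depends_on_post by (intro nn_integral_message) (auto simp: depends_on_def)
  also have "\<dots> \<le> (\<Sum>w\<in>W. \<integral>\<^sup>+x. ennreal 1 \<partial>P)"
    by (intro sum_mono nn_integral_mono ennreal_mult_divide_self_le) auto
  finally show ?thesis by (simp add: emeasure_space_1 ennreal_of_nat_eq_real_of_nat)
qed

lemma integrable_inverse_lik: "integrable P (\<lambda>x. 1 / lik A x)"
  using nn_integral_inverse_lik[of A] by (intro integrableI_nonneg) (auto intro: le_less_trans)

lemma integrable_ln_lik [simp]: "integrable P (\<lambda>x. ln (lik A x))"
proof (rule Bochner_Integration.integrable_bound[OF integrable_inverse_lik])
  show "AE x in P. norm (ln (lik A x)) \<le> norm (1 / lik A x)"
    using AE_lik_pos[of A]
  proof eventually_elim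
    case (elim x)
    have "ln (1 / lik A x) \<le> 1 / lik A x - 1"
      using elim by (intro ln_le_minus_one) auto
    moreover have "ln (1 / lik A x) = - ln (lik A x)" "ln (lik A x) \<le> 0"
      using elim by (auto simp: ln_div)
    ultimately show ?case using elim by auto
  qed
qed auto

definition cond_entropy :: "'i set \<Rightarrow> real" where
  "cond_entropy A = - expectation (\<lambda>x. ln (lik A x))"

lemma cond_entropy_nonneg: "0 \<le> cond_entropy A"
proof -
  have "expectation (\<lambda>x. ln (lik A x)) \<le> expectation (\<lambda>x. 0)"
    using AE_lik_pos[of A] by (intro integral_mono_AE) (auto elim!: eventually_mono)
  then show ?thesis by (simp add: cond_entropy_def)
qed

lemma card_W_pos: "0 < card W"
proof -
  obtain x where "x \<in> space P" using not_empty by blast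
  then show ?thesis using F_in_W finite_W by (auto simp: card_gt_0_iff)
qed

lemma cond_entropy_le: "cond_entropy A \<le> ln (card W)"
proof -
  let ?u = "\<lambda>x. 1 / lik A x / card W"
  have ln_u: "AE x in P. ln (?u x) = - ln (lik A x) - ln (card W)"
    using AE_lik_pos[of A] by eventually_elim (use card_W_pos in \<open>simp add: ln_div ln_mult\<close>)
  have "(\<integral>\<^sup>+x. ennreal (?u x) \<partial>P) = (\<integral>\<^sup>+x. ennreal (1 / lik A x) * ennreal (1 / card W) \<partial>P)"
    by (intro nn_integral_cong) (simp add: ennreal_mult''[symmetric])
  also have "\<dots> = (\<integral>\<^sup>+x. ennreal (1 / lik A x) \<partial>P) * ennreal (1 / card W)"
    by (intro nn_integral_multc) auto
  also have "\<dots> \<le> ennreal (card W) * ennreal (1 / card W)"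
    by (intro mult_right_mono nn_integral_inverse_lik) auto
  also have "\<dots> = 1"
    using card_W_pos by (simp add: ennreal_mult''[symmetric])
  finally have le1: "(\<integral>\<^sup>+x. ennreal (?u x) \<partial>P) \<le> 1" .
  have int: "integrable P (\<lambda>x. - ln (lik A x) - ln (card W))" by simp
  have "expectation (\<lambda>x. ln (?u x)) \<le> 0"
  proof (rule expectation_ln_nonpos[OF _ _ le1])
    show "AE x in P. 0 < ?u x"
      using AE_lik_pos[of A] by eventually_elim (use card_W_pos in simp)
    show "integrable P (\<lambda>x. ln (?u x))"
      using ln_u int by (subst integrable_cong_AE) auto
  qed auto
  also have "expectation (\<lambda>x. ln (?u x)) = expectation (\<lambda>x. - ln (lik A x) - ln (card W))"
    using ln_u by (intro integral_cong_AE) auto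
  also have "\<dots> = cond_entropy A - ln (card W)"
    by (simp add: cond_entropy_def P.prob_space)
  finally show ?thesis by simp
qed

text \<open>Jensen is applied to the ratio \<open>?u\<close>. The posterior weight cancels
  \<open>post (A \<union> B)\<close>; averaging \<open>post B\<close> over the coordinates outside
  \<open>A\<close> gives \<open>post (A \<inter> B)\<close>, which cancels the other denominator.
  What remains is the total mass 1 of \<open>post A\<close>.\<close>

lemma cond_entropy_submodular:
  "cond_entropy (A \<union> B) + cond_entropy (A \<inter> B) \<le> cond_entropy A + cond_entropy B"
proof -
  let ?u = "\<lambda>x. lik A x * lik B x / lik (A \<inter> B) x / lik (A \<union> B) x"
  have ln_u: "AE x in P. ln (?u x) = ln (lik A x) + ln (lik B x) - ln (lik (A \<inter> B) x) - ln (lik (A \<union> B) x)"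
    using AE_lik_pos[of A] AE_lik_pos[of B] AE_lik_pos[of "A \<inter> B"] AE_lik_pos[of "A \<union> B"]
    by eventually_elim (simp add: ln_div ln_mult)
  define k where "k w x = post A w x * post B w x / post (A \<inter> B) w x / post (A \<union> B) w x" for w x
  have [measurable]: "k w \<in> borel_measurable P" for w unfolding k_def by measurable
  have dep: "depends_on (A \<union> B) (k w)" for w
    using depends_on_mono[OF depends_on_post, of A "A \<union> B" w] depends_on_mono[OF depends_on_post, of B "A \<union> B" w]
      depends_on_mono[OF depends_on_post, of "A \<inter> B" "A \<union> B" w] depends_on_post[of "A \<union> B" w]
    unfolding depends_on_def k_def by auto
  have depA: "depends_on A (\<lambda>x. ennreal (post A w x / post (A \<inter> B) w x))" for w
    using depends_on_post[of A w] depends_on_mono[OF depends_on_post, of "A \<inter> B" A w]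
    unfolding depends_on_def by auto
  have "(\<integral>\<^sup>+x. ennreal (?u x) \<partial>P) = (\<integral>\<^sup>+x. ennreal (k (F x) x) \<partial>P)"
    by (simp add: lik_def k_def)
  also have "\<dots> = (\<Sum>w\<in>W. \<integral>\<^sup>+x. ennreal (post (A \<union> B) w x) * ennreal (k w x) \<partial>P)"
    using dep by (intro nn_integral_message) (auto simp: depends_on_def)
  \<comment> \<open>After this grouping the factor beside \<open>post B\<close> depends on
    \<open>A\<close> only, so the tower property averages \<open>post B\<close> alone.\<close>
  also have "\<dots> \<le> (\<Sum>w\<in>W. \<integral>\<^sup>+x. ennreal (post B w x) * ennreal (post A w x / post (A \<inter> B) w x) \<partial>P)"
  proof (intro sum_mono nn_integral_mono)
    fix w x
    have "ennreal (post (A \<union> B) w x) * ennreal (k w x) \<le> ennreal (post A w x * post B w x / post (A \<inter> B) w x)"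
      unfolding k_def by (intro ennreal_mult_divide_self_le) auto
    also have "\<dots> = ennreal (post B w x) * ennreal (post A w x / post (A \<inter> B) w x)"
      by (simp add: ennreal_mult''[symmetric] mult_ac)
    finally show "ennreal (post (A \<union> B) w x) * ennreal (k w x) \<le> \<dots>" .
  qed
  also have "\<dots> = (\<Sum>w\<in>W. \<integral>\<^sup>+x. (\<integral>\<^sup>+y. ennreal (post B w (resample A x y)) \<partial>P) * ennreal (post A w x / post (A \<inter> B) w x) \<partial>P)"
    by (intro sum.cong nn_integral_tower depA) auto
  also have "\<dots> = (\<Sum>w\<in>W. \<integral>\<^sup>+x. ennreal (post (A \<inter> B) w x) * ennreal (post A w x / post (A \<inter> B) w x) \<partial>P)"
    by (intro sum.cong nn_integral_cong) (auto simp: post_split)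
  also have "\<dots> \<le> (\<Sum>w\<in>W. \<integral>\<^sup>+x. ennreal (post A w x) \<partial>P)"
    by (intro sum_mono nn_integral_mono ennreal_mult_divide_self_le) auto
  also have "\<dots> = 1" by (rule sum_post)
  finally have le1: "(\<integral>\<^sup>+x. ennreal (?u x) \<partial>P) \<le> 1" .
  have "expectation (\<lambda>x. ln (?u x)) \<le> 0"
  proof (rule expectation_ln_nonpos[OF _ _ le1])
    show "AE x in P. 0 < ?u x"
      using AE_lik_pos[of A] AE_lik_pos[of B] AE_lik_pos[of "A \<inter> B"] AE_lik_pos[of "A \<union> B"]
      by eventually_elim simp
    show "integrable P (\<lambda>x. ln (?u x))"
      using ln_u by (subst integrable_cong_AE) auto
  qed auto
  also have "expectation (\<lambda>x. ln (?u x)) = expectation (\<lambda>x. ln (lik A x) + ln (lik B x) - ln (lik (A \<inter> B) x) - ln (lik (A \<union> B) x))"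
    using ln_u by (intro integral_cong_AE) auto
  also have "\<dots> = - cond_entropy A - cond_entropy B + cond_entropy (A \<inter> B) + cond_entropy (A \<union> B)"
    by (simp add: cond_entropy_def)
  finally show ?thesis by simp
qed

text \<open>Donsker--Varadhan: \<open>G\<close> is a test function for the conditional mutual information of the message and the
  coordinates in \<open>B - A\<close>.\<close>

lemma cond_entropy_gain:
  fixes G :: "nat \<Rightarrow> ('i \<Rightarrow> 'a) \<Rightarrow> real"
  assumes AB: "A \<subseteq> B"
    and [measurable]: "\<And>w. G w \<in> borel_measurable P"
    and pos: "\<And>w x. x \<in> space P \<Longrightarrow> 0 < G w x"
    and dep: "\<And>w. depends_on B (G w)"
    and avg: "\<And>w x. x \<in> space P \<Longrightarrow> (\<integral>\<^sup>+y. ennreal (G w (resample A x y)) \<partial>P) \<le> 1"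
    and int: "integrable P (\<lambda>x. ln (G (F x) x))"
  shows "expectation (\<lambda>x. ln (G (F x) x)) \<le> cond_entropy A - cond_entropy B"
proof -
  \<comment> \<open>The expected logarithm of this ratio is the left side of the claim minus the
    entropy drop, so mean at most 1 suffices.\<close>
  let ?u = "\<lambda>x. G (F x) x * lik A x / lik B x"
  have [measurable]: "(\<lambda>x. G (F x) x) \<in> borel_measurable P"
    by (rule measurable_compose_countable'[where I=UNIV]) auto
  have ln_u: "AE x in P. ln (?u x) = ln (G (F x) x) + ln (lik A x) - ln (lik B x)"
    using AE_lik_pos[of A] AE_lik_pos[of B] AE_space
    by eventually_elim (use pos in \<open>simp add: ln_div ln_mult less_imp_neq[THEN not_sym]\<close>)
  define k where "k w x = G w x * post A w x / post B w x" for w x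
  have [measurable]: "k w \<in> borel_measurable P" for w unfolding k_def by measurable
  have depk: "depends_on B (k w)" for w
    using depends_on_mono[OF depends_on_post, of A B w] depends_on_post[of B w] dep[of w] AB
    unfolding depends_on_def k_def by auto
  have depA: "depends_on A (\<lambda>x. ennreal (post A w x))" for w
    using depends_on_post[of A w] unfolding depends_on_def by auto
  have "(\<integral>\<^sup>+x. ennreal (?u x) \<partial>P) = (\<integral>\<^sup>+x. ennreal (k (F x) x) \<partial>P)"
    by (simp add: lik_def k_def)
  also have "\<dots> = (\<Sum>w\<in>W. \<integral>\<^sup>+x. ennreal (post B w x) * ennreal (k w x) \<partial>P)"
    using depk by (intro nn_integral_message) (auto simp: depends_on_def)
  also have "\<dots> \<le> (\<Sum>w\<in>W. \<integral>\<^sup>+x. ennreal (G w x) * ennreal (post A w x) \<partial>P)"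
  proof (intro sum_mono nn_integral_mono)
    fix w x assume "x \<in> space P"
    then have "0 < G w x" by (rule pos)
    then have "ennreal (post B w x) * ennreal (k w x) \<le> ennreal (G w x * post A w x)"
      unfolding k_def by (intro ennreal_mult_divide_self_le) auto
    also have "\<dots> = ennreal (G w x) * ennreal (post A w x)"
      by (simp add: ennreal_mult'')
    finally show "ennreal (post B w x) * ennreal (k w x) \<le> \<dots>" .
  qed
  also have "\<dots> = (\<Sum>w\<in>W. \<integral>\<^sup>+x. (\<integral>\<^sup>+y. ennreal (G w (resample A x y)) \<partial>P) * ennreal (post A w x) \<partial>P)"
    by (intro sum.cong nn_integral_tower depA) auto
  also have "\<dots> \<le> (\<Sum>w\<in>W. \<integral>\<^sup>+x. 1 * ennreal (post A w x) \<partial>P)"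
    using avg by (intro sum_mono nn_integral_mono mult_right_mono) auto
  also have "\<dots> = 1" by (simp add: sum_post)
  finally have le1: "(\<integral>\<^sup>+x. ennreal (?u x) \<partial>P) \<le> 1" .
  have "expectation (\<lambda>x. ln (?u x)) \<le> 0"
  proof (rule expectation_ln_nonpos[OF _ _ le1])
    show "AE x in P. 0 < ?u x"
      using AE_lik_pos[of A] AE_lik_pos[of B] AE_space by eventually_elim (use pos in simp)
    have "integrable P (\<lambda>x. ln (G (F x) x) + ln (lik A x) - ln (lik B x))"
      using int by simp
    then show "integrable P (\<lambda>x. ln (?u x))"
      by (rule integrable_cong_AE_imp) (use ln_u in \<open>auto elim: eventually_mono\<close>)
  qed auto
  also have "expectation (\<lambda>x. ln (?u x)) = expectation (\<lambda>x. ln (G (F x) x) + ln (lik A x) - ln (lik B x))"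
    using ln_u by (intro integral_cong_AE) auto
  also have "\<dots> = expectation (\<lambda>x. ln (G (F x) x)) - cond_entropy A + cond_entropy B"
    using int by (simp add: cond_entropy_def)
  finally show ?thesis by simp
qed

lemma cond_entropy_antimono: "A \<subseteq> B \<Longrightarrow> cond_entropy B \<le> cond_entropy A"
  using cond_entropy_gain[of A B "\<lambda>_ _. 1"] by (simp add: depends_on_def emeasure_space_1)

end

section \<open>Gaussian densities\<close>

lemma sets_std_normal [simp, measurable_cong]: "sets std_normal = sets borel"
  and space_std_normal [simp]: "space std_normal = UNIV"
  by (auto simp: std_normal_def)

text \<open>The second parameter is the variance, so that it can be a distortion.\<close>

definition gauss :: "real \<Rightarrow> real \<Rightarrow> real measure" where
  "gauss c d = density lborel (normal_density c (sqrt d))"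

lemma sets_gauss [simp, measurable_cong]: "sets (gauss c d) = sets borel"
  and space_gauss [simp]: "space (gauss c d) = UNIV"
  by (auto simp: gauss_def)

lemma prob_space_gauss: "0 < d \<Longrightarrow> prob_space (gauss c d)"
  unfolding gauss_def by (intro prob_space_normal_density) auto

lemma gauss_moment_even:
  assumes d: "0 < d"
  shows "has_bochner_integral (gauss c d) (\<lambda>x. (x - c) ^ (2 * j)) (fact (2 * j) / ((2 / d) ^ j * fact j))"
proof -
  have "has_bochner_integral lborel (\<lambda>x. normal_density c (sqrt d) x *\<^sub>R (x - c) ^ (2 * j)) (fact (2 * j) / ((2 / d) ^ j * fact j))"
    using normal_moment_even[of "sqrt d" c j] d by simp
  then show ?thesis
    unfolding gauss_def by (intro has_bochner_integral_density) auto
qed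

lemma std_normal_eq_gauss: "std_normal = gauss 0 1"
  by (simp add: std_normal_def gauss_def)

lemma prob_space_std_normal: "prob_space std_normal"
  unfolding std_normal_eq_gauss by (rule prob_space_gauss) simp

lemma std_normal_moment_2: "has_bochner_integral std_normal (\<lambda>x. x\<^sup>2) 1"
  using gauss_moment_even[of 1 0 1] by (simp add: std_normal_eq_gauss)

text \<open>The density of \<^term>\<open>gauss c d\<close> with respect to \<^const>\<open>std_normal\<close>. It serves as the test function of the
  Donsker--Varadhan bound in the converse and as the joint density of source and codeword in the covering argument.\<close>

definition tilt :: "real \<Rightarrow> real \<Rightarrow> real \<Rightarrow> real" where
  "tilt d c x = exp (- (x - c)\<^sup>2 / (2 * d) + x\<^sup>2 / 2) / sqrt d"

lemma tilt_pos: "0 < d \<Longrightarrow> 0 < tilt d c x"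
  by (simp add: tilt_def)

lemma measurable_tilt [measurable (raw)]:
  assumes [measurable]: "c \<in> borel_measurable N" "x \<in> borel_measurable N"
  shows "(\<lambda>z. tilt d (c z) (x z)) \<in> borel_measurable N"
  unfolding tilt_def by measurable

lemma measurable_tilt_std_normal: "(\<lambda>x. ennreal (tilt d c x)) \<in> borel_measurable std_normal"
  by measurable

lemma ln_tilt: "0 < d \<Longrightarrow> ln (tilt d c x) = ln (1 / d) / 2 - (x - c)\<^sup>2 / (2 * d) + x\<^sup>2 / 2"
  by (simp add: tilt_def ln_div ln_sqrt)

lemma density_tilt:
  assumes "0 < d"
  shows "density std_normal (\<lambda>x. ennreal (tilt d c x)) = gauss c d"
proof -
  have "density std_normal (\<lambda>x. ennreal (tilt d c x))
      = density lborel (\<lambda>x. ennreal (std_normal_density x) * ennreal (tilt d c x))"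
    unfolding std_normal_def by (subst density_density_eq) auto
  also have "\<dots> = gauss c d"
    unfolding gauss_def
  proof (intro density_cong AE_I2)
    fix x
    have "std_normal_density x * tilt d c x = normal_density c (sqrt d) x"
      using assms by (simp add: normal_density_def tilt_def real_sqrt_mult exp_add[symmetric] divide_simps flip: exp_add)
    then show "ennreal (std_normal_density x) * ennreal (tilt d c x) = ennreal (normal_density c (sqrt d) x)"
      by (simp add: ennreal_mult'[symmetric])
  qed auto
  finally show ?thesis .
qed

lemma nn_integral_tilt:
  assumes "0 < d"
  shows "(\<integral>\<^sup>+x. ennreal (tilt d c x) \<partial>std_normal) = 1"
proof -
  interpret prob_space "gauss c d"
    using assms by (rule prob_space_gauss)
  have "(\<integral>\<^sup>+x. ennreal (tilt d c x) \<partial>std_normal) = emeasure (density std_normal (\<lambda>x. ennreal (tilt d c x))) (space std_normal)"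
    by (subst emeasure_density) auto
  also have "\<dots> = 1"
    using emeasure_space_1 by (simp add: density_tilt[OF assms])
  finally show ?thesis .
qed

section \<open>The converse\<close>

text \<open>Entropy enters only through boundedness, submodularity, monotonicity and the gain
  \<open>c\<close> per vertex, so the combinatorics is carried out for an arbitrary set
  function.\<close>

lemma odd_cycle_bound:
  fixes f :: "nat set \<Rightarrow> real" and c L :: real
  assumes m: "m \<ge> 5" "odd m"
    and bound: "\<And>S. f S \<le> L" and nonneg: "\<And>S. 0 \<le> f S"
    and submod: "\<And>S T. f (S \<union> T) + f (S \<inter> T) \<le> f S + f T"
    and antimono: "\<And>S T. S \<subseteq> T \<Longrightarrow> f T \<le> f S"
    and gain: "\<And>i S. i < m \<Longrightarrow> i \<notin> S \<Longrightarrow> (i + m - 1) mod m \<in> S \<Longrightarrow> (i + 1) mod m \<in> S \<Longrightarrow> f (insert i S) + c \<le> f S"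
  shows "real m * c \<le> 2 * L"
proof -
  obtain q where q: "m = 2 * q + 1" using m(2) by (rule oddE)
  define r where "r = q - 1"
  have mr: "m = 2 * r + 3" and r: "r \<ge> 1" using q m by (auto simp: r_def)
  \<comment> \<open>For vertices other than 0 and m - 1 no index wraps around, and the neighbours
    are plainly i - 1 and i + 1.\<close>
  have inner: "f (insert i S) + c \<le> f S" if "1 \<le> i" "i + 1 < m" "i \<notin> S" "i - 1 \<in> S" "i + 1 \<in> S" for i S
  proof (rule gain)
    have "i + m - 1 = i - 1 + m" using that by simp
    then have "(i + m - 1) mod m = (i - 1 + m) mod m" by (rule arg_cong)
    also have "\<dots> = i - 1" unfolding mod_add_self2 using that by (intro mod_less) simp
    finally show "(i + m - 1) mod m \<in> S" using that by simp
  qed (use that in auto)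
  \<comment> \<open>The shift \<open>s\<close> selects the even (0) or the odd (1) starting set.
    Step \<open>t\<close> inserts offset 2t + 1, whose neighbours 2t and 2t + 2 both have even
    offset and are already present.\<close>
  have fill: "real t * c + f (((+) s) ` {j. j \<le> 2 * r \<and> (even j \<or> j < 2 * t)}) \<le> L"
    if "t \<le> r" "s \<le> 1" for s t
    using that(1)
  proof (induction t)
    case 0
    then show ?case using bound by simp
  next
    case (Suc t)
    let ?S = "((+) s) ` {j. j \<le> 2 * r \<and> (even j \<or> j < 2 * t)}"
    have "((+) s) ` {j. j \<le> 2 * r \<and> (even j \<or> j < 2 * Suc t)} = ((+) s) ` (insert (2 * t + 1) {j. j \<le> 2 * r \<and> (even j \<or> j < 2 * t)})"
      using Suc.prems by (intro arg_cong[where f="image _"]) (auto simp: less_Suc_eq)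
    also have "\<dots> = insert (s + (2 * t + 1)) ?S" by (simp only: image_insert)
    finally have "f (((+) s) ` {j. j \<le> 2 * r \<and> (even j \<or> j < 2 * Suc t)}) + c = f (insert (s + (2 * t + 1)) ?S) + c"
      by simp
    also have "\<dots> \<le> f ?S"
    proof (rule inner)
      show "s + (2 * t + 1) - 1 \<in> ?S" using Suc.prems by auto
      have "s + (2 * t + 1) + 1 = s + (2 * t + 2)" by simp
      then show "s + (2 * t + 1) + 1 \<in> ?S" using Suc.prems by (auto simp: image_iff)
    qed (use Suc.prems that mr in auto)
    finally show ?case using Suc by (simp add: algebra_simps)
  qed
  have full: "{j. j \<le> 2 * r \<and> (even j \<or> j < 2 * r)} = {..2 * r}"
    by (auto simp: order_le_less)
  have A: "real r * c + f {..2 * r} \<le> L" and B: "real r * c + f {1..2 * r + 1} \<le> L"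
    using fill[of r 0] fill[of r 1] unfolding full
    by (auto simp: atMost_atLeast0)
  have "f {..2 * r + 1} + f {1..2 * r} \<le> f {..2 * r} + f {1..2 * r + 1}"
  proof -
    have "{..2 * r} \<union> {1..2 * r + 1} = {..2 * r + 1}" "{..2 * r} \<inter> {1..2 * r + 1} = {1..2 * r}"
      by auto
    with submod[of "{..2 * r}" "{1..2 * r + 1}"] show ?thesis by simp
  qed
  \<comment> \<open>The last vertex m - 1 = 2r + 2 has neighbours 2r + 1 and, after wrapping,
    0.\<close>
  moreover have "f (insert (2 * r + 2) {..2 * r + 1}) + c \<le> f {..2 * r + 1}"
  proof (rule gain)
    have "2 * r + 2 + m - 1 = 2 * r + 1 + m" by simp
    then have "(2 * r + 2 + m - 1) mod m = (2 * r + 1 + m) mod m" by (rule arg_cong)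
    also have "\<dots> = 2 * r + 1" unfolding mod_add_self2 by (intro mod_less) (simp add: mr)
    finally show "(2 * r + 2 + m - 1) mod m \<in> {..2 * r + 1}" by simp
    have "2 * r + 2 + 1 = m" by (simp add: mr)
    then show "(2 * r + 2 + 1) mod m \<in> {..2 * r + 1}" by simp
  qed (auto simp: mr)
  then have "c \<le> f {..2 * r + 1}"
    using nonneg[of "insert (2 * r + 2) {..2 * r + 1}"] by linarith
  moreover have "2 * c \<le> f {1..2 * r}"
  proof -
    \<comment> \<open>Vertex 0 lies between 2r + 2 and 1, vertex 2r + 1 between 2r and 2r + 2. Since
      r \<ge> 1, the path contains 1 and 2r.\<close>
    let ?S = "insert (2 * r + 2) {1..2 * r}"
    have "f (insert 0 ?S) + c \<le> f ?S"
      using r by (intro gain) (auto simp: mr)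
    moreover have "f (insert (2 * r + 1) (insert 0 ?S)) + c \<le> f (insert 0 ?S)"
      using r by (intro inner) (auto simp: mr)
    moreover have "f ?S \<le> f {1..2 * r}" by (rule antimono) auto
    ultimately show ?thesis using nonneg[of "insert (2 * r + 1) (insert 0 ?S)"] by linarith
  qed
  \<comment> \<open>The count is 2r gains from the two paths, one from vertex 2r + 2 and two from
    vertices 0 and 2r + 1, hence 2r + 3 = m.\<close>
  ultimately show ?thesis using A B unfolding mr by (simp add: algebra_simps)
qed

text \<open>For the gain of component i, the test function \<open>G\<close> is the density, relative
  to the source, of independent Gaussians of variance \<open>d\<close> centred at the
  reconstruction. The bound holds at each fixed blocklength.\<close>

lemma is_code_bound:
  assumes m: "m \<ge> 5" "odd m" and n: "n > 0" and d: "d > 0" and code: "is_code m n M d"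
  shows "real m / 4 * ln (1 / d) * n \<le> ln M"
proof -
  let ?I = "{..<n} \<times> {..<m}"
  from code obtain f g where f [measurable]: "f \<in> measurable (src m n) (count_space UNIV)"
    and f_range: "\<And>x. x \<in> space (src m n) \<Longrightarrow> f x \<in> {1..M}"
    and g: "\<And>i w k. i < m \<Longrightarrow> k < n \<Longrightarrow> (\<lambda>y. g i w y k) \<in> borel_measurable (PiM (side m i n) (\<lambda>_. lborel))"
    and dist: "\<And>i. i < m \<Longrightarrow> ennreal (1 / real n) *
          (\<Sum>k<n. \<integral>\<^sup>+ x. ennreal ((x (k, i) - g i (f x) (restrict x (side m i n)) k)\<^sup>2) \<partial>src m n) \<le> ennreal d"
    unfolding is_code_def by blast
  interpret N: prob_space std_normal by (rule prob_space_std_normal)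
  interpret product_message "\<lambda>_. std_normal" ?I f "{1..M}"
  proof (unfold_locales, goal_cases)
    case 2 show ?case using f by (simp add: src_def)
  qed (use f_range in \<open>auto simp: src_def\<close>)
  have src: "src m n = P" by (simp add: src_def)
  define h where "h S = cond_entropy ({..<n} \<times> S)" for S
  have "real m * (n / 2 * ln (1 / d)) \<le> 2 * ln (card {1..M})"
  proof (rule odd_cycle_bound[OF m, of h])
    show "h S \<le> ln (card {1..M})" for S unfolding h_def by (rule cond_entropy_le)
    show "0 \<le> h S" for S unfolding h_def by (rule cond_entropy_nonneg)
    show "h (S \<union> T) + h (S \<inter> T) \<le> h S + h T" for S T
      using cond_entropy_submodular[of "{..<n} \<times> S" "{..<n} \<times> T"] unfolding h_def
      by (simp add: Sigma_Un_distrib2 Sigma_Int_distrib2)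
    show "h T \<le> h S" if "S \<subseteq> T" for S T
      using that unfolding h_def by (intro cond_entropy_antimono) auto
    fix i S assume i: "i < m" "i \<notin> S" "(i + m - 1) mod m \<in> S" "(i + 1) mod m \<in> S"
    let ?s = "side m i n"
    have s_sub: "?s \<subseteq> ?I" "?s \<subseteq> {..<n} \<times> S"
      using i by (auto simp: side_def)
    have ki: "(k, i) \<in> ?I" if "k < n" for k using that i by auto
    define xhat where "xhat w x k = g i w (restrict x ?s) k" for w x k
    have res [measurable]: "(\<lambda>x. restrict x ?s) \<in> P \<rightarrow>\<^sub>M PiM ?s (\<lambda>_. lborel)"
      by (rule measurable_restrict) (use s_sub in \<open>auto intro!: measurable_component_singleton\<close>)
    have xhat_m [measurable]: "(\<lambda>x. xhat w x k) \<in> borel_measurable P" if "k < n" for w k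
      using measurable_compose[OF res g[OF i(1) that, of w]] by (simp add: xhat_def)
    have comp_m [measurable]: "(\<lambda>x. x (k, i)) \<in> borel_measurable P" if "k < n" for k
      using measurable_component_singleton[OF ki[OF that], of "\<lambda>_. std_normal"]
      unfolding measurable_cong_sets[OF refl sets_std_normal] .
    have xhat_f [measurable]: "(\<lambda>x. xhat (f x) x k) \<in> borel_measurable P" if "k < n" for k
      by (rule measurable_compose_countable'[where I=UNIV]) (use that in auto)
    define G where "G w x = (\<Prod>k<n. tilt d (xhat w x k) (x (k, i)))" for w x
    define e where "e k x = (x (k, i) - xhat (f x) x k)\<^sup>2" for k x
    have e_m [measurable]: "e k \<in> borel_measurable P" if "k < n" for k
      unfolding e_def using that by measurable
    have "(\<Sum>k<n. \<integral>\<^sup>+x. ennreal (e k x) \<partial>P) = ennreal n * (ennreal (1 / n) * (\<Sum>k<n. \<integral>\<^sup>+x. ennreal (e k x) \<partial>P))"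
      using n by (simp add: mult.assoc[symmetric] ennreal_mult''[symmetric])
    also have "\<dots> \<le> ennreal n * ennreal d"
      using dist[OF i(1)] by (intro mult_left_mono) (auto simp: e_def xhat_def src)
    finally have sum_e: "(\<Sum>k<n. \<integral>\<^sup>+x. ennreal (e k x) \<partial>P) \<le> ennreal (n * d)"
      using d by (simp add: ennreal_mult)
    have int_e: "integrable P (e k)" if "k < n" for k
    proof (rule integrableI_nonneg)
      have "(\<integral>\<^sup>+x. ennreal (e k x) \<partial>P) \<le> (\<Sum>k<n. \<integral>\<^sup>+x. ennreal (e k x) \<partial>P)"
        using that by (intro member_le_sum) auto
      also note sum_e
      also have "ennreal (n * d) < \<infinity>" by simp
      finally show "(\<integral>\<^sup>+x. ennreal (e k x) \<partial>P) < \<infinity>" .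
    qed (use that in \<open>auto simp: e_def\<close>)
    have "(\<Sum>k<n. \<integral>\<^sup>+x. ennreal (e k x) \<partial>P) = (\<Sum>k<n. ennreal (expectation (e k)))"
      by (intro sum.cong nn_integral_eq_integral int_e) (auto simp: e_def)
    also have "\<dots> = ennreal (\<Sum>k<n. expectation (e k))"
      by (intro sum_ennreal) (auto simp: e_def)
    finally have sum_e': "(\<Sum>k<n. expectation (e k)) \<le> n * d"
      using sum_e d by (simp add: ennreal_le_iff)
    have sq_i: "integrable P (\<lambda>x. (x (k, i))\<^sup>2)" "expectation (\<lambda>x. (x (k, i))\<^sup>2) = 1" if "k < n" for k
    proof -
      have cm: "(\<lambda>x. x (k, i)) \<in> P \<rightarrow>\<^sub>M std_normal"
        using ki[OF that] by (rule measurable_component_singleton)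
      have eq: "distr P std_normal (\<lambda>x. x (k, i)) = std_normal"
        using PiM_component[OF ki[OF that]] by simp
      have "integrable std_normal (\<lambda>x. x\<^sup>2)" "(\<integral>x. x\<^sup>2 \<partial>std_normal) = 1"
        using std_normal_moment_2 by (auto dest: has_bochner_integral_integral_eq integrable.intros)
      then show "integrable P (\<lambda>x. (x (k, i))\<^sup>2)" "expectation (\<lambda>x. (x (k, i))\<^sup>2) = 1"
        using integrable_distr[OF cm, of "\<lambda>x. x\<^sup>2"] integral_distr[OF cm, of "\<lambda>x. x\<^sup>2"] unfolding eq
        by auto
    qed
    have lnG: "ln (G (f x) x) = (\<Sum>k<n. ln (1 / d) / 2 - e k x / (2 * d) + (x (k, i))\<^sup>2 / 2)" for x
      unfolding G_def using d by (subst ln_prod) (auto simp: tilt_pos tilt_pos[THEN less_imp_neq, THEN not_sym] ln_tilt e_def)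
    have intG: "integrable P (\<lambda>x. ln (G (f x) x))"
      unfolding lnG using int_e sq_i(1)
      by (intro Bochner_Integration.integrable_sum Bochner_Integration.integrable_add Bochner_Integration.integrable_diff integrable_divide) auto
    \<comment> \<open>The quadratic terms balance: the energies contribute n/2, and total squared
      error at most n d costs at most n/2.\<close>
    have "expectation (\<lambda>x. ln (G (f x) x)) = (\<Sum>k<n. ln (1 / d) / 2 - expectation (e k) / (2 * d) + 1 / 2)"
      unfolding lnG using int_e sq_i
      by (subst Bochner_Integration.integral_sum) (auto simp: P.prob_space)
    also have "\<dots> = n / 2 * ln (1 / d) + n / 2 - (\<Sum>k<n. expectation (e k)) / (2 * d)"
      by (simp add: sum.distrib sum_subtractf sum_divide_distrib)
    also have "\<dots> \<ge> n / 2 * ln (1 / d)"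
      using sum_e' d by (simp add: field_simps)
    finally have low: "n / 2 * ln (1 / d) \<le> expectation (\<lambda>x. ln (G (f x) x))" .
    have "expectation (\<lambda>x. ln (G (f x) x)) \<le> cond_entropy ({..<n} \<times> S) - cond_entropy ({..<n} \<times> insert i S)"
    proof (rule cond_entropy_gain[where G=G, OF _ _ _ _ _ intG])
      show "G w \<in> borel_measurable P" for w
        unfolding G_def by measurable
      show "0 < G w x" for w x
        unfolding G_def using d by (intro prod_pos tilt_pos) auto
      show "depends_on ({..<n} \<times> insert i S) (G w)" for w
        unfolding depends_on_def
      proof (intro ballI)
        fix x y assume "x \<in> space P" "y \<in> space P"
        have "restrict (resample ({..<n} \<times> insert i S) x y) ?s = restrict x ?s"
          using s_sub by (auto simp: resample_def restrict_def fun_eq_iff)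
        moreover have "resample ({..<n} \<times> insert i S) x y (k, i) = x (k, i)" if "k < n" for k
          using that i by (simp add: resample_def)
        ultimately show "G w (resample ({..<n} \<times> insert i S) x y) = G w x"
          unfolding G_def xhat_def by (intro prod.cong) auto
      qed
      fix w x assume x: "x \<in> space P"
      \<comment> \<open>Padding with factors 1 off component i makes the integrand a product over
        all coordinates. The centres \<open>xhat w x k\<close> are frozen because the side
        information lies in \<open>S\<close>, so each factor integrates to 1.\<close>
      define q where "q p t = (if snd p = i then ennreal (tilt d (xhat w x (fst p)) t) else 1)" for p t
      have q_m: "q p \<in> borel_measurable std_normal" for p
        unfolding q_def by (cases "snd p = i") (auto intro: measurable_tilt_std_normal)
      have r: "restrict (resample ({..<n} \<times> S) x y) ?s = restrict x ?s" for y
        using s_sub by (auto simp: resample_def restrict_def fun_eq_iff)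
      have s: "resample ({..<n} \<times> S) x y (k, i) = y (k, i)" if "k < n" for k y
        using that i by (simp add: resample_def)
      have "ennreal (G w (resample ({..<n} \<times> S) x y)) = (\<Prod>p\<in>?I. q p (y p))" for y
      proof -
        have "ennreal (G w (resample ({..<n} \<times> S) x y)) = (\<Prod>k<n. ennreal (tilt d (xhat w x k) (y (k, i))))"
          unfolding G_def xhat_def r using d s
          by (subst prod_ennreal) (auto intro!: prod.cong less_imp_le tilt_pos arg_cong[where f=ennreal])
        also have "\<dots> = (\<Prod>k<n. \<Prod>j<m. q (k, j) (y (k, j)))"
        proof (intro prod.cong refl)
          fix k assume "k \<in> {..<n}"
          show "ennreal (tilt d (xhat w x k) (y (k, i))) = (\<Prod>j<m. q (k, j) (y (k, j)))"
            using i(1) by (subst prod.remove[of _ i]) (auto simp: q_def)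
        qed
        finally show ?thesis by (simp add: prod.cartesian_product case_prod_beta)
      qed
      then have "(\<integral>\<^sup>+y. ennreal (G w (resample ({..<n} \<times> S) x y)) \<partial>P) = (\<Prod>p\<in>?I. \<integral>\<^sup>+t. q p t \<partial>std_normal)"
        by (simp, intro product_nn_integral_prod) (auto simp: q_m)
      also have "\<dots> = 1"
      proof (intro prod.neutral ballI)
        fix p show "(\<integral>\<^sup>+t. q p t \<partial>std_normal) = 1"
          unfolding q_def using d N.emeasure_space_1 by (cases "snd p = i") (auto simp: nn_integral_tilt)
      qed
      finally show "(\<integral>\<^sup>+y. ennreal (G w (resample ({..<n} \<times> S) x y)) \<partial>P) \<le> 1" by simp
    qed auto
    with low show "h (insert i S) + n / 2 * ln (1 / d) \<le> h S"
      by (simp add: h_def)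
  qed
  then show ?thesis by (simp add: field_simps)
qed

section \<open>Gaussian covering codes\<close>

text \<open>Under \<open>\<mu> \<Otimes> \<nu>\<close> every set \<open>U\<close> of still uncovered points meets the section of \<open>T\<close> at some \<open>y\<close> in mass at least
  \<open>(\<mu> U - \<eta>) / K\<close>, because the joint law with density \<open>\<Phi> \<le> K\<close> on \<open>T\<close> gives \<open>U\<close> mass \<open>\<mu> U\<close> up to \<open>\<eta>\<close>.
  Choosing such \<open>y\<close> repeatedly replaces random coding.\<close>

lemma greedy_covering:
  fixes \<mu> :: "'a measure" and \<nu> :: "'b measure" and \<Phi> :: "'a \<Rightarrow> 'b \<Rightarrow> real"
  assumes "prob_space \<mu>" "prob_space \<nu>"
    and \<Phi> [measurable]: "(\<lambda>(x, y). \<Phi> x y) \<in> borel_measurable (\<mu> \<Otimes>\<^sub>M \<nu>)"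
    and T [measurable]: "Measurable.pred (\<mu> \<Otimes>\<^sub>M \<nu>) (\<lambda>(x, y). T x y)"
    and K: "1 \<le> K" and \<Phi>_le: "\<And>x y. T x y \<Longrightarrow> \<Phi> x y \<le> K"
    and marginal: "\<And>x. x \<in> space \<mu> \<Longrightarrow> (\<integral>\<^sup>+y. ennreal (\<Phi> x y) \<partial>\<nu>) = 1"
    and \<eta>: "0 \<le> \<eta>"
    and tail: "(\<integral>\<^sup>+x. \<integral>\<^sup>+y. ennreal (\<Phi> x y) * indicator {(x, y). \<not> T x y} (x, y) \<partial>\<nu> \<partial>\<mu>) \<le> ennreal \<eta>"
  shows "\<exists>c. (\<forall>j<N. c j \<in> space \<nu>) \<and> measure \<mu> {x \<in> space \<mu>. \<forall>j<N. \<not> T x (c j)} \<le> \<eta> + (1 - 1 / K) ^ N"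
proof -
  interpret \<mu>: prob_space \<mu> by fact
  interpret \<nu>: prob_space \<nu> by fact
  interpret pair_sigma_finite \<mu> \<nu> ..
  have T_section [measurable]: "Measurable.pred \<mu> (\<lambda>x. T x y)" if "y \<in> space \<nu>" for y
    using measurable_compose[OF measurable_Pair2'[OF that, of \<mu>] T] by simp
  have step: "\<exists>y\<in>space \<nu>. measure \<mu> U - \<eta> \<le> K * measure \<mu> {x \<in> U. T x y}"
    if U [measurable]: "U \<in> sets \<mu>" for U
  proof (rule ccontr)
    assume neg: "\<not> ?thesis"
    define h where "h y = measure \<mu> {x \<in> U. T x y}" for y
    have h_eq: "ennreal (h y) = (\<integral>\<^sup>+x. indicator U x * indicator {(x, y). T x y} (x, y) \<partial>\<mu>)" if y: "y \<in> space \<nu>" for y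
    proof -
      have "{x \<in> U. T x y} = {x \<in> space \<mu>. x \<in> U \<and> T x y}"
        using sets.sets_into_space[OF U] by auto
      also have "\<dots> \<in> sets \<mu>" using y by measurable
      finally have S: "{x \<in> U. T x y} \<in> sets \<mu>" .
      have "(\<integral>\<^sup>+x. indicator U x * indicator {(x, y). T x y} (x, y) \<partial>\<mu>) = (\<integral>\<^sup>+x. indicator {x \<in> U. T x y} x \<partial>\<mu>)"
        by (intro nn_integral_cong) (auto simp: indicator_def)
      then show ?thesis using S by (simp add: h_def \<mu>.emeasure_eq_measure)
    qed
    have ind [measurable]: "(\<lambda>z. indicator {(x, y). T x y} z :: ennreal) \<in> borel_measurable (\<mu> \<Otimes>\<^sub>M \<nu>)"
    proof -
      have "(\<lambda>z. if (case z of (x, y) \<Rightarrow> T x y) then 1 else 0 :: ennreal) \<in> borel_measurable (\<mu> \<Otimes>\<^sub>M \<nu>)"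
        by measurable
      then show ?thesis by (simp add: indicator_def case_prod_beta)
    qed
    have h_m [measurable]: "h \<in> borel_measurable \<nu>"
    proof -
      have "(\<lambda>y. enn2real (\<integral>\<^sup>+x. indicator U x * indicator {(x, y). T x y} (x, y) \<partial>\<mu>)) \<in> borel_measurable \<nu>"
        by measurable
      also have "?this \<longleftrightarrow> ?thesis"
        by (intro measurable_cong) (simp add: h_eq[symmetric] h_def)
      finally show ?thesis .
    qed
    have h_nonneg: "0 \<le> h y" for y by (simp add: h_def)
    have h_int: "integrable \<nu> h"
      by (rule \<nu>.integrable_const_bound[where B=1]) (auto simp: h_def)
    have split: "indicator U x * ennreal (\<Phi> x y) \<le>
        ennreal K * (indicator U x * indicator {(x, y). T x y} (x, y)) + ennreal (\<Phi> x y) * indicator {(x, y). \<not> T x y} (x, y)" for x y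
      using \<Phi>_le[of x y] by (auto simp: indicator_def intro: ennreal_leI)
    have ind' [measurable]: "(\<lambda>z. indicator {(x, y). \<not> T x y} z :: ennreal) \<in> borel_measurable (\<mu> \<Otimes>\<^sub>M \<nu>)"
    proof -
      have "(\<lambda>z. if (case z of (x, y) \<Rightarrow> T x y) then 0 else 1 :: ennreal) \<in> borel_measurable (\<mu> \<Otimes>\<^sub>M \<nu>)"
        by measurable
      also have "(\<lambda>z. if (case z of (x, y) \<Rightarrow> T x y) then 0 else 1 :: ennreal) = (\<lambda>z. indicator {(x, y). \<not> T x y} z)"
        by (auto simp: indicator_def fun_eq_iff)
      finally show ?thesis .
    qed
    \<comment> \<open>Since \<Phi> has marginal 1, the mass of \<open>U\<close> is its joint mass;
      this is then split according to \<open>T\<close>.\<close>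
    have "emeasure \<mu> U = (\<integral>\<^sup>+x. indicator U x * (\<integral>\<^sup>+y. ennreal (\<Phi> x y) \<partial>\<nu>) \<partial>\<mu>)"
      using marginal by (simp cong: nn_integral_cong)
    also have "\<dots> = (\<integral>\<^sup>+x. \<integral>\<^sup>+y. indicator U x * ennreal (\<Phi> x y) \<partial>\<nu> \<partial>\<mu>)"
      by (intro nn_integral_cong nn_integral_cmult[symmetric]) measurable
    also have "\<dots> \<le> (\<integral>\<^sup>+x. \<integral>\<^sup>+y. ennreal K * (indicator U x * indicator {(x, y). T x y} (x, y)) + ennreal (\<Phi> x y) * indicator {(x, y). \<not> T x y} (x, y) \<partial>\<nu> \<partial>\<mu>)"
      by (intro nn_integral_mono split)
    also have "\<dots> = (\<integral>\<^sup>+x. (\<integral>\<^sup>+y. ennreal K * (indicator U x * indicator {(x, y). T x y} (x, y)) \<partial>\<nu>)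
        + (\<integral>\<^sup>+y. ennreal (\<Phi> x y) * indicator {(x, y). \<not> T x y} (x, y) \<partial>\<nu>) \<partial>\<mu>)"
      by (intro nn_integral_cong nn_integral_add) measurable
    also have "\<dots> = (\<integral>\<^sup>+x. \<integral>\<^sup>+y. ennreal K * (indicator U x * indicator {(x, y). T x y} (x, y)) \<partial>\<nu> \<partial>\<mu>)
        + (\<integral>\<^sup>+x. \<integral>\<^sup>+y. ennreal (\<Phi> x y) * indicator {(x, y). \<not> T x y} (x, y) \<partial>\<nu> \<partial>\<mu>)"
      by (intro nn_integral_add) measurable
    also have "\<dots> \<le> (\<integral>\<^sup>+x. \<integral>\<^sup>+y. ennreal K * (indicator U x * indicator {(x, y). T x y} (x, y)) \<partial>\<nu> \<partial>\<mu>) + ennreal \<eta>"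
      by (intro add_left_mono tail)
    also have "(\<integral>\<^sup>+x. \<integral>\<^sup>+y. ennreal K * (indicator U x * indicator {(x, y). T x y} (x, y)) \<partial>\<nu> \<partial>\<mu>)
        = (\<integral>\<^sup>+y. \<integral>\<^sup>+x. ennreal K * (indicator U x * indicator {(x, y). T x y} (x, y)) \<partial>\<mu> \<partial>\<nu>)"
      by (rule Fubini'[symmetric]) measurable
    also have "\<dots> = (\<integral>\<^sup>+y. ennreal K * ennreal (h y) \<partial>\<nu>)"
      by (intro nn_integral_cong) (subst nn_integral_cmult, measurable, simp add: h_eq)
    also have "\<dots> = ennreal K * ennreal (\<nu>.expectation h)"
      using h_int by (subst nn_integral_cmult) (auto simp: h_nonneg nn_integral_eq_integral)
    also have "ennreal K * ennreal (\<nu>.expectation h) + ennreal \<eta> = ennreal (K * \<nu>.expectation h + \<eta>)"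
      using K \<eta> by (subst ennreal_plus) (auto simp: ennreal_mult'' h_nonneg)
    finally have ge: "measure \<mu> U \<le> K * \<nu>.expectation h + \<eta>"
      using K \<eta> by (simp add: \<mu>.emeasure_eq_measure h_nonneg flip: ennreal_plus)
    \<comment> \<open>If no \<open>y\<close> were good enough, \<open>h\<close> would stay strictly
      below the threshold everywhere, against the lower bound \<open>ge\<close> on its
      average.\<close>
    have "\<nu>.expectation h < (measure \<mu> U - \<eta>) / K"
    proof (rule \<nu>.expectation_less)
      show "AE y in \<nu>. h y < (measure \<mu> U - \<eta>) / K"
        using neg K by (intro AE_I2) (auto simp: h_def field_simps not_le)
    qed (rule h_int)
    with ge K show False by (simp add: field_simps)
  qed
  have pow: "0 \<le> 1 - 1 / K" using K by simp
  show ?thesis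
  proof (induction N)
    case 0
    then show ?case using \<eta> by (simp add: \<mu>.prob_space)
  next
    case (Suc N)
    then obtain c where c: "\<And>j. j < N \<Longrightarrow> c j \<in> space \<nu>"
      and IH: "measure \<mu> {x \<in> space \<mu>. \<forall>j<N. \<not> T x (c j)} \<le> \<eta> + (1 - 1 / K) ^ N" by blast
    define U where "U = {x \<in> space \<mu>. \<forall>j<N. \<not> T x (c j)}"
    have U [measurable]: "U \<in> sets \<mu>"
    proof -
      have "U = {x \<in> space \<mu>. \<forall>j\<in>{..<N}. \<not> T x (c j)}" by (auto simp: U_def)
      also have "\<dots> \<in> sets \<mu>" using c by measurable
      finally show ?thesis .
    qed
    obtain y where y: "y \<in> space \<nu>" "measure \<mu> U - \<eta> \<le> K * measure \<mu> {x \<in> U. T x y}"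
      using step[OF U] by blast
    have S: "{x \<in> U. T x y} \<in> sets \<mu>"
    proof -
      have "{x \<in> U. T x y} = {x \<in> space \<mu>. x \<in> U \<and> T x y}" by (auto simp: U_def)
      also have "\<dots> \<in> sets \<mu>" using y(1) by measurable
      finally show ?thesis .
    qed
    have "{x \<in> space \<mu>. \<forall>j<Suc N. \<not> T x ((c(N := y)) j)} = U - {x \<in> U. T x y}"
      by (auto simp: U_def less_Suc_eq)
    then have "measure \<mu> {x \<in> space \<mu>. \<forall>j<Suc N. \<not> T x ((c(N := y)) j)} = measure \<mu> U - measure \<mu> {x \<in> U. T x y}"
      using S by (simp add: \<mu>.finite_measure_Diff)
    also have "\<dots> \<le> measure \<mu> U - (measure \<mu> U - \<eta>) / K"
      using y(2) K by (simp add: field_simps)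
    \<comment> \<open>The excess of the uncovered mass over \<eta> shrinks by the factor 1 - 1/K
      with each new codeword.\<close>
    also have "\<dots> = \<eta> + (measure \<mu> U - \<eta>) * (1 - 1 / K)"
      using K by (simp add: field_simps)
    also have "\<dots> \<le> \<eta> + (1 - 1 / K) ^ N * (1 - 1 / K)"
      using IH pow by (intro add_left_mono mult_right_mono) (auto simp: U_def)
    finally have "measure \<mu> {x \<in> space \<mu>. \<forall>j<Suc N. \<not> T x ((c(N := y)) j)} \<le> \<eta> + (1 - 1 / K) ^ Suc N"
      by (simp add: mult.commute)
    moreover have "\<forall>j<Suc N. (c(N := y)) j \<in> space \<nu>" using c y by (auto simp: less_Suc_eq)
    ultimately show ?case by blast
  qed
qed

section \<open>Product densities and Gaussian second moments\<close>

lemma PiM_density: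
  fixes f :: "'i \<Rightarrow> 'a \<Rightarrow> ennreal"
  assumes "finite I" and f [measurable]: "\<And>i. f i \<in> borel_measurable (M i)"
    and "product_sigma_finite M" "product_sigma_finite (\<lambda>i. density (M i) (f i))"
  shows "PiM I (\<lambda>i. density (M i) (f i)) = density (PiM I M) (\<lambda>x. \<Prod>i\<in>I. f i (x i))"
proof -
  interpret M: product_sigma_finite M by fact
  interpret D: product_sigma_finite "\<lambda>i. density (M i) (f i)" by fact
  show ?thesis
  proof (rule D.PiM_eqI[symmetric])
    show "finite I" by fact
    show "sets (density (PiM I M) (\<lambda>x. \<Prod>i\<in>I. f i (x i))) = sets (PiM I (\<lambda>i. density (M i) (f i)))"
      by (auto intro!: sets_PiM_cong)
    fix A assume A: "\<And>i. i \<in> I \<Longrightarrow> A i \<in> sets (density (M i) (f i))"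
    then have [measurable]: "Pi\<^sub>E I A \<in> sets (PiM I M)"
      using \<open>finite I\<close> by (intro sets_PiM_I_finite) auto
    have "emeasure (density (PiM I M) (\<lambda>x. \<Prod>i\<in>I. f i (x i))) (Pi\<^sub>E I A)
        = (\<integral>\<^sup>+x. (\<Prod>i\<in>I. f i (x i)) * indicator (Pi\<^sub>E I A) x \<partial>PiM I M)"
      by (subst emeasure_density) auto
    also have "\<dots> = (\<integral>\<^sup>+x. (\<Prod>i\<in>I. f i (x i) * indicator (A i) (x i)) \<partial>PiM I M)"
    proof (intro nn_integral_cong)
      fix x assume "x \<in> space (PiM I M)"
      then have "x \<in> extensional I" by (auto simp: space_PiM PiE_iff)
      then have "indicator (Pi\<^sub>E I A) x = (\<Prod>i\<in>I. indicator (A i) (x i) :: ennreal)"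
        using \<open>finite I\<close> by (auto simp: indicator_def PiE_iff)
      then show "(\<Prod>i\<in>I. f i (x i)) * indicator (Pi\<^sub>E I A) x = (\<Prod>i\<in>I. f i (x i) * indicator (A i) (x i))"
        by (simp add: prod.distrib)
    qed
    also have "\<dots> = (\<Prod>i\<in>I. \<integral>\<^sup>+t. f i t * indicator (A i) t \<partial>M i)"
    proof (intro M.product_nn_integral_prod \<open>finite I\<close>)
      fix i assume "i \<in> I"
      then have [measurable]: "A i \<in> sets (M i)" using A by simp
      show "(\<lambda>t. f i t * indicator (A i) t) \<in> borel_measurable (M i)" by measurable
    qed
    also have "\<dots> = (\<Prod>i\<in>I. emeasure (density (M i) (f i)) (A i))"
      using A by (intro prod.cong) (auto simp: emeasure_density)
    finally show "emeasure (density (PiM I M) (\<lambda>x. \<Prod>i\<in>I. f i (x i))) (Pi\<^sub>E I A) = (\<Prod>i\<in>I. emeasure (density (M i) (f i)) (A i))" .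
  qed
qed

text \<open>The mixed terms of the expanded square vanish by independence and zero means. This is
  the variance input for Chebyshev's inequality.\<close>

lemma (in finite_product_prob_space) second_moment_sum:
  fixes h :: "'a \<Rightarrow> 'b \<Rightarrow> real" and v :: real
  assumes int: "\<And>i. i \<in> I \<Longrightarrow> integrable (M i) (h i)"
    and mean: "\<And>i. i \<in> I \<Longrightarrow> integral\<^sup>L (M i) (h i) = 0"
    and sq: "\<And>i. i \<in> I \<Longrightarrow> has_bochner_integral (M i) (\<lambda>t. (h i t)\<^sup>2) v"
  shows "has_bochner_integral (Pi\<^sub>M I M) (\<lambda>x. (\<Sum>i\<in>I. h i (x i))\<^sup>2) (card I * v)"
proof -
  have one: "has_bochner_integral (Pi\<^sub>M I M) (\<lambda>x. h i (x i) * h j (x j)) (if i = j then v else 0)"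
    if ij: "i \<in> I" "j \<in> I" for i j
  proof (cases "i = j")
    case True
    have cm: "(\<lambda>x. x i) \<in> P \<rightarrow>\<^sub>M M i" using ij by measurable
    have "integrable (M i) (\<lambda>t. (h i t)\<^sup>2)" "(\<integral>t. (h i t)\<^sup>2 \<partial>M i) = v"
      using sq[OF ij(1)] by (auto dest: has_bochner_integral_integral_eq integrable.intros)
    moreover have "(\<lambda>t. (h i t)\<^sup>2) \<in> borel_measurable (M i)"
      using calculation(1) by auto
    ultimately show ?thesis
      using integrable_distr[OF cm, of "\<lambda>t. (h i t)\<^sup>2"] integral_distr[OF cm, of "\<lambda>t. (h i t)\<^sup>2"] PiM_component[OF ij(1)] True
      by (auto simp: has_bochner_integral_iff power2_eq_square)
  next
    case False
    define q where "q l = (if l = i \<or> l = j then h l else (\<lambda>_. 1))" for l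
    have q_int: "integrable (M l) (q l)" if "l \<in> I" for l
      using int[OF that] by (auto simp: q_def)
    have q_prod: "(\<Prod>l\<in>I. q l (x l)) = h i (x i) * h j (x j)" for x
    proof -
      have "(\<Prod>l\<in>I. q l (x l)) = q i (x i) * (q j (x j) * (\<Prod>l\<in>I - {i} - {j}. q l (x l)))"
        using ij False finite_index by (subst prod.remove[of _ i], simp, simp, subst prod.remove[of _ j]) auto
      also have "(\<Prod>l\<in>I - {i} - {j}. q l (x l)) = 1" by (intro prod.neutral) (auto simp: q_def)
      finally show ?thesis by (simp add: q_def)
    qed
    have "(\<Prod>l\<in>I. integral\<^sup>L (M l) (q l)) = 0"
      using ij finite_index mean[OF ij(1)] by (intro prod_zero) (auto simp: q_def intro!: bexI[of _ i])
    then show ?thesis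
      using product_integrable_prod[OF finite_index q_int] product_integral_prod[OF finite_index q_int] False
      by (simp add: has_bochner_integral_iff q_prod)
  qed
  have "has_bochner_integral (Pi\<^sub>M I M) (\<lambda>x. \<Sum>i\<in>I. \<Sum>j\<in>I. h i (x i) * h j (x j)) (\<Sum>i\<in>I. \<Sum>j\<in>I. if i = j then v else 0)"
    by (intro has_bochner_integral_sum one)
  also have "(\<lambda>x. \<Sum>i\<in>I. \<Sum>j\<in>I. h i (x i) * h j (x j)) = (\<lambda>x. (\<Sum>i\<in>I. h i (x i))\<^sup>2)"
    by (simp add: power2_eq_square sum_product)
  also have "(\<Sum>i\<in>I. \<Sum>j\<in>I. if i = j then v else 0) = card I * v"
    using finite_index by simp
  finally show ?thesis .
qed

lemma finite_product_prob_space_gauss: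
  assumes "0 < d" "finite I"
  shows "finite_product_prob_space (\<lambda>k. gauss (c k) d) I"
proof -
  interpret prob_space "gauss (c k) d" for k using assms by (intro prob_space_gauss)
  show ?thesis using assms by unfold_locales
qed

text \<open>The normalized square of a Gaussian has mean 1 and fourth moment 3, hence variance 3 - 2
  + 1 = 2.\<close>

lemma gauss_deviation:
  assumes d: "0 < d"
  shows "has_bochner_integral (gauss c d) (\<lambda>x. (x - c)\<^sup>2 / d - 1) 0"
    and "has_bochner_integral (gauss c d) (\<lambda>x. ((x - c)\<^sup>2 / d - 1)\<^sup>2) 2"
proof -
  have m2: "has_bochner_integral (gauss c d) (\<lambda>x. (x - c)\<^sup>2) d"
    using gauss_moment_even[OF d, of c 1] d by simp
  have m4: "has_bochner_integral (gauss c d) (\<lambda>x. (x - c) ^ 4) (3 * d\<^sup>2)"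
    using gauss_moment_even[OF d, of c 2] d by (simp add: fact_numeral power2_eq_square)
  have one: "has_bochner_integral (gauss c d) (\<lambda>x. 1 :: real) 1"
    using prob_space_gauss[OF d, of c]
    by (simp add: has_bochner_integral_iff prob_space.prob_space[of "gauss c d", simplified] finite_measure.integrable_const prob_space.finite_measure)
  have "has_bochner_integral (gauss c d) (\<lambda>x. (x - c)\<^sup>2 / d - 1) (d / d - 1)"
    using d by (intro has_bochner_integral_diff has_bochner_integral_divide m2 one)
  then show "has_bochner_integral (gauss c d) (\<lambda>x. (x - c)\<^sup>2 / d - 1) 0"
    using d by simp
  have "has_bochner_integral (gauss c d) (\<lambda>x. (x - c) ^ 4 / d\<^sup>2 - 2 * ((x - c)\<^sup>2 / d) + 1) (3 * d\<^sup>2 / d\<^sup>2 - 2 * (d / d) + 1)"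
    using d by (intro has_bochner_integral_add has_bochner_integral_diff has_bochner_integral_divide has_bochner_integral_mult_right m2 m4 one)
  moreover have "(x - c) ^ 4 / d\<^sup>2 - 2 * ((x - c)\<^sup>2 / d) + 1 = ((x - c)\<^sup>2 / d - 1)\<^sup>2" for x
    unfolding power2_diff[of "(x - c)\<^sup>2 / d"] by (simp add: power_divide power_mult[symmetric])
  ultimately show "has_bochner_integral (gauss c d) (\<lambda>x. ((x - c)\<^sup>2 / d - 1)\<^sup>2) 2"
    using d by simp
qed

lemma nn_integral_deviation:
  fixes n :: nat
  assumes d: "0 < d"
  shows "(\<integral>\<^sup>+x. ennreal ((\<Sum>k<n. (x k - c k)\<^sup>2 / d - 1)\<^sup>2) \<partial>PiM {..<n} (\<lambda>k. gauss (c k) d)) = ennreal (2 * n)"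
proof -
  interpret finite_product_prob_space "\<lambda>k. gauss (c k) d" "{..<n}"
    using d by (intro finite_product_prob_space_gauss) auto
  have "has_bochner_integral (PiM {..<n} (\<lambda>k. gauss (c k) d)) (\<lambda>x. (\<Sum>k<n. (x k - c k)\<^sup>2 / d - 1)\<^sup>2) (real (card {..<n}) * 2)"
    using gauss_deviation[OF d] by (intro second_moment_sum) (auto simp: has_bochner_integral_iff)
  then show ?thesis
    by (subst nn_integral_eq_integral) (auto simp: has_bochner_integral_iff mult.commute)
qed

text \<open>Change of measure: under the joint density the source, given a codeword, consists of
  independent Gaussians around it.\<close>

lemma nn_integral_tilt_prod:
  fixes n :: nat
  assumes d: "0 < d" and [measurable]: "H \<in> borel_measurable (PiM {..<n} (\<lambda>_. std_normal))"
  shows "(\<integral>\<^sup>+x. ennreal (\<Prod>k<n. tilt d (c k) (x k)) * H x \<partial>PiM {..<n} (\<lambda>_. std_normal))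
    = (\<integral>\<^sup>+x. H x \<partial>PiM {..<n} (\<lambda>k. gauss (c k) d))"
proof -
  interpret G: finite_product_prob_space "\<lambda>k. gauss (c k) d" "{..<n}"
    using d by (intro finite_product_prob_space_gauss) auto
  interpret S: finite_product_prob_space "\<lambda>k. std_normal" "{..<n}"
    unfolding std_normal_eq_gauss by (intro finite_product_prob_space_gauss) auto
  have "PiM {..<n} (\<lambda>k. gauss (c k) d) = PiM {..<n} (\<lambda>k. density std_normal (\<lambda>x. ennreal (tilt d (c k) x)))"
    using d by (simp add: density_tilt)
  also have "\<dots> = density (PiM {..<n} (\<lambda>_. std_normal)) (\<lambda>x. \<Prod>k<n. ennreal (tilt d (c k) (x k)))"
  proof (rule PiM_density)
    show "product_sigma_finite (\<lambda>k. density std_normal (\<lambda>x. ennreal (tilt d (c k) x)))"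
      using d G.product_sigma_finite_axioms by (simp add: density_tilt)
  qed (auto intro: measurable_tilt_std_normal S.product_sigma_finite_axioms)
  finally have "(\<integral>\<^sup>+x. H x \<partial>PiM {..<n} (\<lambda>k. gauss (c k) d))
      = (\<integral>\<^sup>+x. (\<Prod>k<n. ennreal (tilt d (c k) (x k))) * H x \<partial>PiM {..<n} (\<lambda>_. std_normal))"
    by (simp add: nn_integral_density)
  also have "\<dots> = (\<integral>\<^sup>+x. ennreal (\<Prod>k<n. tilt d (c k) (x k)) * H x \<partial>PiM {..<n} (\<lambda>_. std_normal))"
    using d by (intro nn_integral_cong) (subst prod_ennreal, auto intro: less_imp_le tilt_pos)
  finally show ?thesis by simp
qed

section \<open>The Gaussian test channel and its quantizer\<close>

text \<open>With this scaling \<open>tilt\<close> is the density of a pair of standard normals with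
  correlation \<open>sqrt (1 - d)\<close>, relative to the independent pair, hence symmetric. Both
  marginals are therefore standard normal.\<close>

lemma tilt_symmetric:
  assumes "0 < d" "d \<le> 1"
  shows "tilt d (sqrt (1 - d) * y) x = tilt d (sqrt (1 - d) * x) y"
proof -
  have s: "(sqrt (1 - d))\<^sup>2 = 1 - d" using assms by simp
  have "- (x - sqrt (1 - d) * y)\<^sup>2 / (2 * d) + x\<^sup>2 / 2 = - (y - sqrt (1 - d) * x)\<^sup>2 / (2 * d) + y\<^sup>2 / 2"
    using assms by (simp add: power2_diff power_mult_distrib s field_simps)
  then show ?thesis by (simp add: tilt_def)
qed

text \<open>Greedy covering for the channel X = aY + noise of variance D, with a = sqrt(1 - D). In
  the bound, 4 / (n \<eta>^2) is the Chebyshev failure mass, and the terms 2n(...) + 2 pay for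
  uncovered points, which are reproduced as 0.\<close>

lemma quantizer_exists:
  fixes n N :: nat and D \<eta> :: real
  defines "G \<equiv> PiM {..<n} (\<lambda>_. std_normal)" and "K \<equiv> exp (n * (ln (1 / D) / 2 + \<eta>))"
  assumes D: "0 < D" "D \<le> 1" and \<eta>: "0 < \<eta>" and n: "0 < n"
  shows "\<exists>J c. J \<in> G \<rightarrow>\<^sub>M count_space UNIV \<and> (\<forall>x. J x \<le> N) \<and>
    (\<integral>\<^sup>+x. ennreal (\<Sum>k<n. (x k - c (J x) k)\<^sup>2) \<partial>G)
      \<le> ennreal (n * D * (1 + \<eta>) + 2 * n * (4 / (n * \<eta>\<^sup>2) + (1 - 1 / K) ^ N) + 2)"
proof -
  define a where "a = sqrt (1 - D)"
  define \<Phi> where "\<Phi> x y = (\<Prod>k<n. tilt D (a * y k) (x k))" for x y :: "nat \<Rightarrow> real"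
  \<comment> \<open>The first condition yields the distortion, the second the density bound required
    for covering.\<close>
  define T where "T x y \<longleftrightarrow> (\<Sum>k<n. (x k - a * y k)\<^sup>2) \<le> n * D * (1 + \<eta>) \<and> \<Phi> x y \<le> K" for x y :: "nat \<Rightarrow> real"
  define Q where "Q x = (\<Sum>k<n. (x k)\<^sup>2 - 1)" for x :: "nat \<Rightarrow> real"
  define R where "R x y = (\<Sum>k<n. (x k - a * y k)\<^sup>2 / D - 1)" for x y :: "nat \<Rightarrow> real"
  interpret S: finite_product_prob_space "\<lambda>k. std_normal" "{..<n}"
    unfolding std_normal_eq_gauss by (intro finite_product_prob_space_gauss) auto
  interpret G: prob_space G unfolding G_def by (rule S.P.prob_space_axioms)
  interpret GG: pair_sigma_finite G G ..
  have comp [measurable]: "(\<lambda>x. x k) \<in> borel_measurable G" if "k < n" for k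
    using measurable_component_singleton[of k "{..<n}" "\<lambda>_. std_normal"] that
    unfolding measurable_cong_sets[OF refl sets_std_normal] G_def by simp
  have comp1 [measurable]: "(\<lambda>z. fst z k) \<in> borel_measurable (G \<Otimes>\<^sub>M G)" "(\<lambda>z. snd z k) \<in> borel_measurable (G \<Otimes>\<^sub>M G)" if "k < n" for k
    using that by (auto intro: measurable_compose[OF _ comp])
  have \<Phi>_m [measurable]: "(\<lambda>z. \<Phi> (fst z) (snd z)) \<in> borel_measurable (G \<Otimes>\<^sub>M G)"
    unfolding \<Phi>_def by measurable
  have T_m [measurable]: "Measurable.pred (G \<Otimes>\<^sub>M G) (\<lambda>z. T (fst z) (snd z))"
    unfolding T_def by measurable
  have Q_m [measurable]: "Q \<in> borel_measurable G" unfolding Q_def by measurable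
  have R_m [measurable]: "(\<lambda>z. R (fst z) (snd z)) \<in> borel_measurable (G \<Otimes>\<^sub>M G)"
    unfolding R_def by measurable
  have \<Phi>_sym: "\<Phi> x y = \<Phi> y x" for x y
    unfolding \<Phi>_def a_def using D by (intro prod.cong tilt_symmetric) auto
  have \<Phi>_pos: "0 < \<Phi> x y" for x y
    unfolding \<Phi>_def using D by (intro prod_pos tilt_pos) auto
  have marg: "(\<integral>\<^sup>+y. ennreal (\<Phi> x y) \<partial>G) = 1" for x
  proof -
    interpret Y: finite_product_prob_space "\<lambda>k. gauss (a * x k) D" "{..<n}"
      using D by (intro finite_product_prob_space_gauss) auto
    have "(\<integral>\<^sup>+y. ennreal (\<Phi> y x) * 1 \<partial>G) = 1"
      unfolding \<Phi>_def G_def using D by (subst nn_integral_tilt_prod) (auto simp: Y.P.emeasure_space_1)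
    then show ?thesis by (simp add: \<Phi>_sym)
  qed
  have EQ: "(\<integral>\<^sup>+x. ennreal ((Q x)\<^sup>2) \<partial>G) = ennreal (2 * n)"
    using nn_integral_deviation[of 1 n "\<lambda>_. 0"] by (simp add: Q_def G_def std_normal_eq_gauss)
  have ER: "(\<integral>\<^sup>+x. ennreal (\<Phi> x y) * ennreal ((R x y)\<^sup>2) \<partial>G) = ennreal (2 * n)" if "y \<in> space G" for y
  proof -
    have [measurable]: "(\<lambda>x. R x y) \<in> borel_measurable G" unfolding R_def by measurable
    have "(\<integral>\<^sup>+x. ennreal (\<Phi> x y) * ennreal ((R x y)\<^sup>2) \<partial>G) = (\<integral>\<^sup>+x. ennreal ((R x y)\<^sup>2) \<partial>PiM {..<n} (\<lambda>k. gauss (a * y k) D))"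
      unfolding \<Phi>_def G_def using D by (intro nn_integral_tilt_prod) (auto simp: G_def[symmetric])
    also have "\<dots> = ennreal (2 * n)"
      unfolding R_def using D by (intro nn_integral_deviation)
    finally show ?thesis .
  qed
  \<comment> \<open>The log-density is n/2 ln(1/D) + (Q - R)/2, so the deviation \<open>Q\<close> of
    the source energy and \<open>R\<close> of the noise energy control both conditions.\<close>
  have T_if: "T x y" if Q: "\<bar>Q x\<bar> \<le> n * \<eta>" and R: "\<bar>R x y\<bar> \<le> n * \<eta>" for x y
  proof -
    let ?s = "\<Sum>k<n. (x k - a * y k)\<^sup>2"
    have Req: "R x y = ?s / D - n" by (simp add: R_def sum_subtractf sum_divide_distrib)
    have Qeq: "Q x = (\<Sum>k<n. (x k)\<^sup>2) - n" by (simp add: Q_def sum_subtractf)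
    have "?s / D \<le> n * (1 + \<eta>)" using R Req by (simp add: algebra_simps abs_le_iff)
    then have 1: "?s \<le> n * D * (1 + \<eta>)" using D by (simp add: field_simps)
    have "ln (\<Phi> x y) = (\<Sum>k<n. ln (tilt D (a * y k) (x k)))"
      unfolding \<Phi>_def using D by (intro ln_prod) (auto simp: tilt_pos tilt_pos[THEN less_imp_neq, THEN not_sym])
    also have "\<dots> = n * (ln (1 / D) / 2) + (Q x - R x y) / 2"
      unfolding Req Qeq using D
      by (simp add: ln_tilt sum.distrib sum_subtractf diff_divide_distrib flip: sum_divide_distrib)
    also have "\<dots> \<le> n * (ln (1 / D) / 2 + \<eta>)"
      using Q R by (simp add: algebra_simps abs_le_iff)
    finally have "exp (ln (\<Phi> x y)) \<le> K" unfolding K_def by (rule exp_mono)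
    then have "\<Phi> x y \<le> K" using \<Phi>_pos[of x y] by simp
    with 1 show ?thesis by (simp add: T_def)
  qed
  let ?b = "1 / (n * \<eta>)\<^sup>2"
  have cheb: "indicator {(x, y). \<not> T x y} (x, y) \<le> ennreal ((Q x)\<^sup>2) * ennreal ?b + ennreal ((R x y)\<^sup>2) * ennreal ?b" for x y
  proof (cases "T x y")
    case False
    have pos: "0 < n * \<eta>" using n \<eta> by simp
    from False T_if[of x y] have "n * \<eta> < \<bar>Q x\<bar> \<or> n * \<eta> < \<bar>R x y\<bar>" by force
    then have "(n * \<eta>)\<^sup>2 \<le> (Q x)\<^sup>2 \<or> (n * \<eta>)\<^sup>2 \<le> (R x y)\<^sup>2"
      using pos by (auto simp flip: abs_le_square_iff)
    then have "(n * \<eta>)\<^sup>2 \<le> (Q x)\<^sup>2 + (R x y)\<^sup>2"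
      using zero_le_power2[of "Q x"] zero_le_power2[of "R x y"] by linarith
    then have "1 \<le> ((Q x)\<^sup>2 + (R x y)\<^sup>2) * ?b"
      using zero_less_power[OF pos, of 2] by (simp only: times_divide_eq_right mult_1_right le_divide_eq_1_pos)
    then have "1 \<le> ennreal ((Q x)\<^sup>2 * ?b + (R x y)\<^sup>2 * ?b)"
      by (simp add: add_divide_distrib del: ennreal_plus)
    also have "\<dots> = ennreal ((Q x)\<^sup>2) * ennreal ?b + ennreal ((R x y)\<^sup>2) * ennreal ?b"
      by (simp add: ennreal_mult''[symmetric])
    finally show ?thesis using False by simp
  qed auto
  \<comment> \<open>Two variances 2n, each divided by (n \<eta>)^2.\<close>
  have b2: "ennreal (2 * n) * ennreal ?b + ennreal (2 * n) * ennreal ?b = ennreal (4 / (n * \<eta>\<^sup>2))"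
  proof -
    have "ennreal (2 * n) * ennreal ?b = ennreal (2 * n * ?b)"
      by (rule ennreal_mult[symmetric]) auto
    then have "ennreal (2 * n) * ennreal ?b + ennreal (2 * n) * ennreal ?b = ennreal (2 * n * ?b) + ennreal (2 * n * ?b)"
      by (simp only:)
    also have "\<dots> = ennreal (2 * n * ?b + 2 * n * ?b)"
      by (rule ennreal_plus[symmetric]) auto
    also have "2 * n * ?b + 2 * n * ?b = 4 / (n * \<eta>\<^sup>2)"
      using n \<eta> by (simp add: power2_eq_square field_simps)
    finally show ?thesis .
  qed
  have tail: "(\<integral>\<^sup>+x. \<integral>\<^sup>+y. ennreal (\<Phi> x y) * indicator {(x, y). \<not> T x y} (x, y) \<partial>G \<partial>G) \<le> ennreal (4 / (n * \<eta>\<^sup>2))"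
  proof -
    have "(\<integral>\<^sup>+x. \<integral>\<^sup>+y. ennreal (\<Phi> x y) * indicator {(x, y). \<not> T x y} (x, y) \<partial>G \<partial>G)
      \<le> (\<integral>\<^sup>+x. \<integral>\<^sup>+y. ennreal (\<Phi> x y) * (ennreal ((Q x)\<^sup>2) * ennreal ?b + ennreal ((R x y)\<^sup>2) * ennreal ?b) \<partial>G \<partial>G)"
      by (intro nn_integral_mono mult_left_mono cheb) auto
    also have "\<dots> = (\<integral>\<^sup>+x. \<integral>\<^sup>+y. ennreal (\<Phi> x y) * (ennreal ((Q x)\<^sup>2) * ennreal ?b) + ennreal (\<Phi> x y) * ennreal ((R x y)\<^sup>2) * ennreal ?b \<partial>G \<partial>G)"
      by (simp add: distrib_left mult.assoc)
    also have "\<dots> = (\<integral>\<^sup>+x. (\<integral>\<^sup>+y. ennreal (\<Phi> x y) * (ennreal ((Q x)\<^sup>2) * ennreal ?b) \<partial>G) + (\<integral>\<^sup>+y. ennreal (\<Phi> x y) * ennreal ((R x y)\<^sup>2) * ennreal ?b \<partial>G) \<partial>G)"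
    proof (intro nn_integral_cong nn_integral_add)
      fix x assume "x \<in> space G"
      have [measurable]: "(\<lambda>y. \<Phi> x y) \<in> borel_measurable G" "(\<lambda>y. R x y) \<in> borel_measurable G"
        unfolding R_def \<Phi>_def by measurable
      show "(\<lambda>y. ennreal (\<Phi> x y) * (ennreal ((Q x)\<^sup>2) * ennreal ?b)) \<in> borel_measurable G"
        "(\<lambda>y. ennreal (\<Phi> x y) * ennreal ((R x y)\<^sup>2) * ennreal ?b) \<in> borel_measurable G"
        by measurable
    qed
    also have "\<dots> = (\<integral>\<^sup>+x. (\<integral>\<^sup>+y. ennreal (\<Phi> x y) * (ennreal ((Q x)\<^sup>2) * ennreal ?b) \<partial>G) \<partial>G) + (\<integral>\<^sup>+x. (\<integral>\<^sup>+y. ennreal (\<Phi> x y) * ennreal ((R x y)\<^sup>2) * ennreal ?b \<partial>G) \<partial>G)"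
      by (intro nn_integral_add) (auto intro!: G.borel_measurable_nn_integral simp: case_prod_beta)
    also have "(\<integral>\<^sup>+x. (\<integral>\<^sup>+y. ennreal (\<Phi> x y) * (ennreal ((Q x)\<^sup>2) * ennreal ?b) \<partial>G) \<partial>G) = (\<integral>\<^sup>+x. ennreal ((Q x)\<^sup>2) * ennreal ?b \<partial>G)"
    proof (intro nn_integral_cong)
      fix x assume "x \<in> space G"
      have [measurable]: "(\<lambda>y. \<Phi> x y) \<in> borel_measurable G"
        unfolding \<Phi>_def by measurable
      show "(\<integral>\<^sup>+y. ennreal (\<Phi> x y) * (ennreal ((Q x)\<^sup>2) * ennreal ?b) \<partial>G) = ennreal ((Q x)\<^sup>2) * ennreal ?b"
        by (subst nn_integral_multc) (auto simp: marg)
    qed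
    also have "\<dots> = ennreal (2 * n) * ennreal ?b"
      by (subst nn_integral_multc) (auto simp: EQ)
    \<comment> \<open>The \<open>Q\<close> term needed only the marginal in \<open>y\<close>; for
      \<open>R\<close> the order is exchanged, because with \<open>y\<close> fixed the density makes
      the noise Gaussian.\<close>
    also have "(\<integral>\<^sup>+x. (\<integral>\<^sup>+y. ennreal (\<Phi> x y) * ennreal ((R x y)\<^sup>2) * ennreal ?b \<partial>G) \<partial>G)
       = (\<integral>\<^sup>+y. (\<integral>\<^sup>+x. ennreal (\<Phi> x y) * ennreal ((R x y)\<^sup>2) * ennreal ?b \<partial>G) \<partial>G)"
      by (rule GG.Fubini'[symmetric]) (simp add: case_prod_beta)
    also have "\<dots> = (\<integral>\<^sup>+y. ennreal (2 * n) * ennreal ?b \<partial>G)"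
    proof (intro nn_integral_cong)
      fix y assume y: "y \<in> space G"
      have [measurable]: "(\<lambda>x. \<Phi> x y) \<in> borel_measurable G" "(\<lambda>x. R x y) \<in> borel_measurable G"
        unfolding \<Phi>_def R_def by measurable
      show "(\<integral>\<^sup>+x. ennreal (\<Phi> x y) * ennreal ((R x y)\<^sup>2) * ennreal ?b \<partial>G) = ennreal (2 * n) * ennreal ?b"
        using y by (subst nn_integral_multc) (auto simp: ER)
    qed
    also have "\<dots> = ennreal (2 * n) * ennreal ?b"
      by (simp add: G.emeasure_space_1)
    also note b2
    finally show ?thesis .
  qed
  have K1: "1 \<le> K"
    unfolding K_def using D \<eta> by (intro one_le_exp_iff[THEN iffD2] mult_nonneg_nonneg add_nonneg_nonneg) auto
  obtain c where c: "\<And>j. j < N \<Longrightarrow> c j \<in> space G"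
    and cov: "measure G {x \<in> space G. \<forall>j<N. \<not> T x (c j)} \<le> 4 / (n * \<eta>\<^sup>2) + (1 - 1 / K) ^ N"
  proof -
    have "\<exists>c. (\<forall>j<N. c j \<in> space G) \<and> measure G {x \<in> space G. \<forall>j<N. \<not> T x (c j)} \<le> 4 / (n * \<eta>\<^sup>2) + (1 - 1 / K) ^ N"
      using T_m \<Phi>_m by (intro greedy_covering[where \<Phi>=\<Phi>] G.prob_space_axioms K1 marg tail)
        (auto simp: T_def case_prod_beta)
    then show ?thesis using that by blast
  qed
  \<comment> \<open>Index \<open>N\<close> is the default for uncovered points, with codeword 0 in
    \<open>c'\<close>; the quantizer thus takes up to N + 1 values. Choosing the least index keeps
    it measurable.\<close>
  define J where "J x = (LEAST j. j = N \<or> T x (c j) \<and> j < N)" for x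
  define c' where "c' j k = (if j < N then a * c j k else 0)" for j k
  have J_or: "J x = N \<or> T x (c (J x)) \<and> J x < N" and J_le: "J x \<le> N" for x
    using LeastI[of "\<lambda>j. j = N \<or> T x (c j) \<and> j < N" N] Least_le[of "\<lambda>j. j = N \<or> T x (c j) \<and> j < N" N]
    by (auto simp: J_def)
  have J_N: "\<not> T x (c j)" if "J x = N" "j < N" for x j
    using that Least_le[of "\<lambda>j. j = N \<or> T x (c j) \<and> j < N" j] by (auto simp: J_def)
  have T_sec [measurable]: "Measurable.pred G (\<lambda>x. T x y)" for y
    unfolding T_def \<Phi>_def by measurable
  have J_m: "J \<in> G \<rightarrow>\<^sub>M count_space UNIV"
    unfolding J_def by measurable
  define U where "U = {x \<in> space G. \<forall>j<N. \<not> T x (c j)}"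
  have U [measurable]: "U \<in> sets G"
  proof -
    have "U = {x \<in> space G. \<forall>j\<in>{..<N}. \<not> T x (c j)}" by (auto simp: U_def)
    also have "\<dots> \<in> sets G" by measurable
    finally show ?thesis .
  qed
  have pt: "(\<Sum>k<n. (x k - c' (J x) k)\<^sup>2) \<le> n * D * (1 + \<eta>) + 2 * n * (indicator U x :: real) + (Q x)\<^sup>2 / n" if "x \<in> space G" for x
  proof (cases "J x < N")
    case True
    then have "T x (c (J x))" using J_or[of x] by auto
    then have "(\<Sum>k<n. (x k - c' (J x) k)\<^sup>2) \<le> n * D * (1 + \<eta>)"
      using True by (simp add: T_def c'_def)
    moreover have "0 \<le> 2 * n * (indicator U x :: real)" "0 \<le> (Q x)\<^sup>2 / n" by auto
    ultimately show ?thesis by linarith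
  next
    case False
    then have "J x = N" using J_le[of x] by simp
    then have "x \<in> U" using that J_N by (auto simp: U_def)
    have "(\<Sum>k<n. (x k - c' (J x) k)\<^sup>2) = n + Q x"
      using False by (simp add: c'_def Q_def sum_subtractf)
    \<comment> \<open>Completing the square separates the energy of uncovered points into a constant
      2n on \<open>U\<close> and a term whose expectation is 2, so no product of \<open>Q\<close>
      with an indicator has to be integrated.\<close>
    moreover have "n + Q x \<le> 2 * n + (Q x)\<^sup>2 / n"
    proof -
      have "0 \<le> (Q x - n / 2)\<^sup>2" by simp
      then have "n * Q x \<le> (Q x)\<^sup>2 + (n / 2)\<^sup>2" by (simp add: power2_diff mult.commute)
      also have "\<dots> \<le> (Q x)\<^sup>2 + real n * n" by (simp add: power2_eq_square)
      finally show ?thesis using n by (simp add: field_simps)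
    qed
    moreover have "0 \<le> n * D * (1 + \<eta>)" using D \<eta> by simp
    ultimately show ?thesis using \<open>x \<in> U\<close> by simp
  qed
  have ennreal_lin: "ennreal A + ennreal B * ennreal C + ennreal E * ennreal H = ennreal (A + B * C + E * H)"
    if "0 \<le> A" "0 \<le> B" "0 \<le> C" "0 \<le> E" "0 \<le> H" for A B C E H :: real
    using that by (simp add: ennreal_mult)
  have "(\<integral>\<^sup>+x. ennreal (\<Sum>k<n. (x k - c' (J x) k)\<^sup>2) \<partial>G)
      \<le> (\<integral>\<^sup>+x. ennreal (n * D * (1 + \<eta>)) + ennreal (2 * n) * indicator U x + ennreal ((Q x)\<^sup>2) * ennreal (1 / n) \<partial>G)"
  proof (intro nn_integral_mono)
    fix x assume "x \<in> space G"
    have "ennreal (n * D * (1 + \<eta>)) + ennreal (2 * n) * indicator U x + ennreal ((Q x)\<^sup>2) * ennreal (1 / n)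
       = ennreal (n * D * (1 + \<eta>) + 2 * n * (indicator U x :: real) + (Q x)\<^sup>2 * (1 / n))"
      unfolding ennreal_indicator[symmetric] using D \<eta> by (intro ennreal_lin) auto
    then show "ennreal (\<Sum>k<n. (x k - c' (J x) k)\<^sup>2) \<le> ennreal (n * D * (1 + \<eta>)) + ennreal (2 * n) * indicator U x + ennreal ((Q x)\<^sup>2) * ennreal (1 / n)"
      using pt[OF \<open>x \<in> space G\<close>] by (simp del: ennreal_plus add: ennreal_leI)
  qed
  also have "\<dots> = ennreal (n * D * (1 + \<eta>)) + ennreal (2 * n) * emeasure G U + ennreal (2 * n) * ennreal (1 / n)"
    by (simp add: nn_integral_add nn_integral_multc nn_integral_cmult_indicator EQ G.emeasure_space_1)
  also have "\<dots> = ennreal (n * D * (1 + \<eta>) + 2 * n * measure G U + 2)"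
    unfolding G.emeasure_eq_measure using D \<eta> n by (subst ennreal_lin) auto
  also have "\<dots> \<le> ennreal (n * D * (1 + \<eta>) + 2 * n * (4 / (n * \<eta>\<^sup>2) + (1 - 1 / K) ^ N) + 2)"
    using cov by (intro ennreal_leI add_mono mult_left_mono order_refl) (auto simp: U_def)
  finally show ?thesis using J_m J_le by blast
qed

lemma gaussian_quantizer:
  fixes D \<epsilon> :: real
  assumes D: "0 < D" "D \<le> 1" and \<epsilon>: "0 < \<epsilon>"
  shows "\<forall>\<^sub>F n in sequentially. \<exists>N J c. 1 \<le> N \<and> J \<in> PiM {..<n} (\<lambda>_. std_normal) \<rightarrow>\<^sub>M count_space UNIV \<and>
    (\<forall>x. J x < N) \<and> ln (real N) \<le> n * (ln (1 / D) / 2 + \<epsilon>) \<and>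
    (\<integral>\<^sup>+x. ennreal (\<Sum>k<n. (x k - c (J x) k)\<^sup>2) \<partial>PiM {..<n} (\<lambda>_. std_normal)) \<le> ennreal (n * (D + \<epsilon>))"
proof -
  \<comment> \<open>One \<eta> is spent inside the covering lemma, the other on the vanishing terms,
    for the rate as for the distortion.\<close>
  define \<eta> where "\<eta> = \<epsilon> / 2"
  have \<eta>: "0 < \<eta>" using \<epsilon> by (simp add: \<eta>_def)
  have "(\<lambda>n. ln (real n + 2) / n) \<longlonglongrightarrow> 0" by real_asymp
  then have ev1: "\<forall>\<^sub>F n in sequentially. ln (real n + 2) / n < \<eta>"
    using \<eta> by (rule order_tendstoD(2))
  have "(\<lambda>n. (8 / \<eta>\<^sup>2) * (1 / real n) + 2 * exp (- real n) + 2 / n) \<longlonglongrightarrow> (8 / \<eta>\<^sup>2) * 0 + 2 * 0 + 0"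
    by (intro tendsto_add tendsto_mult tendsto_const; real_asymp)
  then have "(\<lambda>n. (8 / \<eta>\<^sup>2) * (1 / real n) + 2 * exp (- real n) + 2 / n) \<longlonglongrightarrow> 0"
    by simp
  then have ev2: "\<forall>\<^sub>F n in sequentially. (8 / \<eta>\<^sup>2) * (1 / real n) + 2 * exp (- real n) + 2 / n < \<eta>"
    using \<eta> by (rule order_tendstoD(2))
  from ev1 ev2 eventually_gt_at_top[of 0] show ?thesis
  proof eventually_elim
    case (elim n)
    then have n: "0 < n" by simp
    define K where "K = exp (n * (ln (1 / D) / 2 + \<eta>))"
    have K1: "1 \<le> K"
      unfolding K_def using D \<eta> by (intro one_le_exp_iff[THEN iffD2] mult_nonneg_nonneg add_nonneg_nonneg) auto
    \<comment> \<open>Taking n K codewords instead of K makes the covering failure at most exp(-n)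
      and adds only about ln n to the log-size.\<close>
    define N where "N = nat \<lceil>n * K\<rceil>"
    have N_ge: "n * K \<le> N" and N_le: "N \<le> n * K + 1"
      unfolding N_def using K1 by (auto simp: le_nat_iff of_nat_nat)
    obtain J c where J: "J \<in> PiM {..<n} (\<lambda>_. std_normal) \<rightarrow>\<^sub>M count_space UNIV" "\<And>x. J x \<le> N"
      and e: "(\<integral>\<^sup>+x. ennreal (\<Sum>k<n. (x k - c (J x) k)\<^sup>2) \<partial>PiM {..<n} (\<lambda>_. std_normal))
      \<le> ennreal (n * D * (1 + \<eta>) + 2 * n * (4 / (n * \<eta>\<^sup>2) + (1 - 1 / K) ^ N) + 2)"
      using quantizer_exists[OF D \<eta> n, of N] unfolding K_def by blast
    have "(1 - 1 / K) ^ N \<le> exp (- 1 / K) ^ N"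
      using K1 exp_ge_add_one_self[of "- 1 / K"] by (intro power_mono) auto
    also have "\<dots> = exp (- (N / K))" by (simp flip: exp_of_nat_mult)
    also have "\<dots> \<le> exp (- real n)"
      using N_ge K1 by (simp add: field_simps)
    finally have pw: "(1 - 1 / K) ^ N \<le> exp (- real n)" .
    have "n * D * (1 + \<eta>) + 2 * n * (4 / (n * \<eta>\<^sup>2) + (1 - 1 / K) ^ N) + 2
        \<le> n * D * (1 + \<eta>) + 2 * n * (4 / (n * \<eta>\<^sup>2) + exp (- real n)) + 2"
      using pw by (intro add_mono mult_left_mono order_refl) auto
    also have "\<dots> = n * (D + D * \<eta> + ((8 / \<eta>\<^sup>2) * (1 / real n) + 2 * exp (- real n) + 2 / n))"
      using n \<eta> by (simp add: field_simps)
    also have "\<dots> \<le> n * (D + 1 * \<eta> + \<eta>)"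
      using elim D \<eta> by (intro mult_left_mono add_mono order_refl mult_right_mono) auto
    also have "\<dots> = n * (D + \<epsilon>)" by (simp add: \<eta>_def)
    finally have "(\<integral>\<^sup>+x. ennreal (\<Sum>k<n. (x k - c (J x) k)\<^sup>2) \<partial>PiM {..<n} (\<lambda>_. std_normal)) \<le> ennreal (n * (D + \<epsilon>))"
      using e by (meson ennreal_leI order_trans)
    moreover have "ln (real (Suc N)) \<le> n * (ln (1 / D) / 2 + \<epsilon>)"
    proof -
      \<comment> \<open>One unit comes from rounding up, one from the default index; both are
        absorbed by K \<ge> 1.\<close>
      have "real (Suc N) \<le> (n + 2) * K" using N_le K1 by (simp add: algebra_simps)
      then have "ln (real (Suc N)) \<le> ln ((n + 2) * K)" by (intro ln_mono) auto
      also have "\<dots> = ln (real n + 2) + n * (ln (1 / D) / 2 + \<eta>)"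
        using K1 by (subst ln_mult) (auto simp: K_def add.commute)
      also have "\<dots> \<le> n * \<eta> + n * (ln (1 / D) / 2 + \<eta>)"
        using elim n by (simp add: field_simps)
      also have "\<dots> = n * (ln (1 / D) / 2 + \<epsilon>)" by (simp add: \<eta>_def algebra_simps)
      finally show ?thesis .
    qed
    ultimately show ?case
      using J by (intro exI[of _ "Suc N"] exI[of _ J] exI[of _ c]) (auto simp: less_Suc_eq_le)
  qed
qed

section \<open>Index coding on the cycle\<close>

lemma digit_sum_less:
  fixes s :: "nat \<Rightarrow> nat"
  assumes "\<And>i. i < m \<Longrightarrow> s i < N"
  shows "(\<Sum>i<m. s i * N ^ i) < N ^ m"
  using assms
proof (induction m)
  case (Suc m)
  then have "(\<Sum>i<m. s i * N ^ i) < N ^ m" "s m + 1 \<le> N" by (auto simp: Suc_le_eq)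
  then have "(\<Sum>i<Suc m. s i * N ^ i) < N ^ m + s m * N ^ m" by simp
  also have "\<dots> = (s m + 1) * N ^ m" by simp
  also have "\<dots> \<le> N * N ^ m" using \<open>s m + 1 \<le> N\<close> by (rule mult_right_mono) simp
  finally show ?case by simp
qed simp

text \<open>The m edge symbols are packed into one message as base-N digits; this recovers each of
  them.\<close>

lemma digit_sum_digit:
  fixes s :: "nat \<Rightarrow> nat"
  assumes "\<And>i. i < m \<Longrightarrow> s i < N" "j < m"
  shows "(\<Sum>i<m. s i * N ^ i) div N ^ j mod N = s j"
  using assms
proof (induction m)
  case (Suc m)
  have N: "0 < N" using Suc.prems(1)[of j] Suc.prems(2) by linarith
  show ?case
  proof (cases "j = m")
    case True
    have "(\<Sum>i<m. s i * N ^ i) < N ^ m" using Suc.prems by (intro digit_sum_less) auto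
    then show ?thesis using True N Suc.prems by (simp add: div_add1_eq)
  next
    case False
    then have j: "j < m" using Suc.prems by simp
    then have "N ^ m = N ^ j * (N * N ^ (m - Suc j))"
      by (simp flip: power_Suc power_add)
    then have "(\<Sum>i<Suc m. s i * N ^ i) = (\<Sum>i<m. s i * N ^ i) + N ^ j * (N * (s m * N ^ (m - Suc j)))"
      by (simp add: mult_ac)
    then have "(\<Sum>i<Suc m. s i * N ^ i) div N ^ j = ((\<Sum>i<m. s i * N ^ i) + N ^ j * (N * (s m * N ^ (m - Suc j)))) div N ^ j"
      by (rule arg_cong)
    also have "\<dots> = N * (s m * N ^ (m - Suc j)) + (\<Sum>i<m. s i * N ^ i) div N ^ j"
      using N by (intro div_mult_self2) simp
    finally have "(\<Sum>i<Suc m. s i * N ^ i) div N ^ j = N * (s m * N ^ (m - Suc j)) + (\<Sum>i<m. s i * N ^ i) div N ^ j" .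
    then show ?thesis using Suc j by simp
  qed
qed simp

text \<open>A decoder removes the known neighbour's index from an edge symbol. Adding
  \<open>N\<close> first keeps natural subtraction from truncating.\<close>

lemma mod_sub_cancel:
  fixes a b N :: nat
  assumes "a < N" "b < N"
  shows "((a + b) mod N + N - b) mod N = a"
proof (cases "a + b < N")
  case True
  then show ?thesis using assms by simp
next
  case False
  then have "(a + b) mod N = a + b - N" using assms by (simp add: mod_if)
  then show ?thesis using assms False by simp
qed

text \<open>The m edges carry one symbol modulo N each, hence N^m messages. The two blocks have the
  law of a fresh source block of length h, so each costs at most \<delta>.\<close>

lemma is_code_from_quantizer:
  fixes m n h N :: nat and d \<delta> :: real
  assumes m: "m \<ge> 2" and h: "h \<le> n" "n \<le> 2 * h" "0 < n"
    and J [measurable]: "J \<in> PiM {..<h} (\<lambda>_. std_normal) \<rightarrow>\<^sub>M count_space UNIV"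
    and J_less: "\<And>x. J x < N"
    and e: "(\<integral>\<^sup>+x. ennreal (\<Sum>k<h. (x k - c (J x) k)\<^sup>2) \<partial>PiM {..<h} (\<lambda>_. std_normal)) \<le> ennreal \<delta>"
    and \<delta>: "0 \<le> \<delta>" "2 * \<delta> \<le> n * d"
  shows "is_code m n (N ^ m) d"
proof -
  \<comment> \<open>The two blocks of length \<open>h\<close> start at \<open>0\<close> and \<open>n - h\<close>; for odd \<open>n\<close> they overlap in one time instant.\<close>
  define blk where "blk b i x = (\<lambda>k\<in>{..<h}. x (k + b, i))" for b i :: nat and x :: "nat \<times> nat \<Rightarrow> real"
  define o1 where "o1 = n - h"
  define nxt where "nxt i = (i + 1) mod m" for i
  define prv where "prv i = (i + m - 1) mod m" for i
  \<comment> \<open>Symbol of the edge from i to its successor: the block starting at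
    \<open>o1\<close> plays b and the one starting at 0 plays a.\<close>
  define s where "s i x = (J (blk o1 i x) + J (blk 0 (nxt i) x)) mod N" for i x
  \<comment> \<open>The offset 1 moves the packed value into the range {1..M}; \<open>dig\<close>
    undoes it.\<close>
  define f where "f x = 1 + (\<Sum>i<m. s i x * N ^ i)" for x
  define dig where "dig w i = (w - 1) div N ^ i mod N" for w i :: nat
  define g where "g i w y k = (if k < h then c ((dig w (prv i) + N - J (blk o1 (prv i) y)) mod N) k
     else c ((dig w i + N - J (blk 0 (nxt i) y)) mod N) (k - o1))" for i w y k
  have N: "0 < N" using J_less[of undefined] by linarith
  have nxt_prv: "nxt (prv i) = i" "prv i < m" "nxt i < m" if "i < m" for i
  proof -
    have "nxt (prv i) = (i + m - 1 + 1) mod m" unfolding nxt_def prv_def by (rule mod_add_left_eq)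
    also have "i + m - 1 + 1 = i + m" using m by simp
    finally show "nxt (prv i) = i" using that by simp
  qed (use m in \<open>auto simp: nxt_def prv_def\<close>)
  have blk_m: "blk b i \<in> PiM S M \<rightarrow>\<^sub>M PiM {..<h} (\<lambda>_. std_normal)"
    if "\<And>k. k < h \<Longrightarrow> (k + b, i) \<in> S" "\<And>p. p \<in> S \<Longrightarrow> sets (M p) = sets borel" for b i S and M :: "nat \<times> nat \<Rightarrow> real measure"
    unfolding blk_def
  proof (rule measurable_restrict)
    fix k assume "k \<in> {..<h}"
    then have p: "(k + b, i) \<in> S" using that by simp
    have "(\<lambda>x. x (k + b, i)) \<in> PiM S M \<rightarrow>\<^sub>M M (k + b, i)" using p by (rule measurable_component_singleton)
    then show "(\<lambda>x. x (k + b, i)) \<in> PiM S M \<rightarrow>\<^sub>M std_normal"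
      using that(2)[OF p] by (simp cong: measurable_cong_sets)
  qed
  have off: "k < h \<Longrightarrow> k + b < n" if "b = 0 \<or> b = o1" for k b
    using that h by (auto simp: o1_def)
  have Jsrc [measurable]: "(\<lambda>x. J (blk b i x)) \<in> src m n \<rightarrow>\<^sub>M count_space UNIV" if "b = 0 \<or> b = o1" "i < m" for b i
    unfolding src_def by (rule measurable_compose[OF blk_m J]) (use that off in auto)
  have s_less: "s i x < N" for i x using N by (simp add: s_def)
  have f_m: "f \<in> src m n \<rightarrow>\<^sub>M count_space UNIV"
  proof -
    have [measurable]: "s i \<in> src m n \<rightarrow>\<^sub>M count_space UNIV" if "i < m" for i
      unfolding s_def using that nxt_prv by measurable
    show ?thesis unfolding f_def by measurable
  qed
  have f_range: "f x \<in> {1..N ^ m}" for x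
    using digit_sum_less[of m "\<lambda>i. s i x" N] s_less by (auto simp: f_def)
  have dig_f: "dig (f x) i = s i x" if "i < m" for i x
    using digit_sum_digit[of m "\<lambda>i. s i x" N i] s_less that by (simp add: f_def dig_def)
  have side_mem: "(k, prv i) \<in> side m i n" "(k, nxt i) \<in> side m i n" if "k < n" for k i
    using that by (auto simp: side_def prv_def nxt_def)
  have g_m: "(\<lambda>y. g i w y k) \<in> borel_measurable (PiM (side m i n) (\<lambda>_. lborel))" if "i < m" for i w k
  proof -
    have [measurable]: "(\<lambda>y. J (blk b j y)) \<in> PiM (side m i n) (\<lambda>_. lborel) \<rightarrow>\<^sub>M count_space UNIV"
      if "b = 0 \<or> b = o1" "j = prv i \<or> j = nxt i" for b j
      by (rule measurable_compose[OF blk_m J]) (use that off h in \<open>auto intro!: side_mem\<close>)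
    show ?thesis unfolding g_def
      by (cases "k < h") (auto intro!: measurable_compose[where N="count_space UNIV" and g="\<lambda>j. c j _"])
  qed
  have blk_res: "blk b j (restrict x (side m i n)) = blk b j x" if "b = 0 \<or> b = o1" "j = prv i \<or> j = nxt i" for b j i x
    using that off[of b] by (auto simp: blk_def fun_eq_iff side_mem less_le_trans[OF _ h(1)])
  have g_eq: "g i (f x) (restrict x (side m i n)) k =
      (if k < h then c (J (blk 0 i x)) k else c (J (blk o1 i x)) (k - o1))" if i: "i < m" for i x k
  proof -
    have "(dig (f x) (prv i) + N - J (blk o1 (prv i) x)) mod N = J (blk 0 i x)"
      using mod_sub_cancel[OF J_less J_less, of "blk 0 i x" "blk o1 (prv i) x"] nxt_prv[OF i]
      by (simp add: dig_f s_def add.commute)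
    moreover have "(dig (f x) i + N - J (blk 0 (nxt i) x)) mod N = J (blk o1 i x)"
      using mod_sub_cancel[OF J_less J_less, of "blk o1 i x" "blk 0 (nxt i) x"] i
      by (simp add: dig_f s_def)
    ultimately show ?thesis by (simp add: g_def blk_res)
  qed
  define q where "q b i x = (\<Sum>k<h. (blk b i x k - c (J (blk b i x)) k)\<^sup>2)" for b i x
  have q_le: "(\<integral>\<^sup>+x. ennreal (q b i x) \<partial>src m n) \<le> ennreal \<delta>" if b: "b = 0 \<or> b = o1" and i: "i < m" for b i
  proof -
    have m1: "blk b i \<in> src m n \<rightarrow>\<^sub>M PiM {..<h} (\<lambda>_. std_normal)"
      unfolding src_def by (rule blk_m) (use b i off in auto)
    have m2: "(\<lambda>x. ennreal (\<Sum>k<h. (x k - c (J x) k)\<^sup>2)) \<in> borel_measurable (PiM {..<h} (\<lambda>_. std_normal))"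
    proof -
      have [measurable]: "(\<lambda>x. x k) \<in> borel_measurable (PiM {..<h} (\<lambda>_. std_normal))" if "k < h" for k
        using measurable_component_singleton[of k "{..<h}" "\<lambda>_. std_normal"] that
        unfolding measurable_cong_sets[OF refl sets_std_normal] by simp
      have [measurable]: "(\<lambda>x. c (J x) k) \<in> borel_measurable (PiM {..<h} (\<lambda>_. std_normal))" for k
        by (rule measurable_compose[OF J]) simp
      show ?thesis by measurable
    qed
    have "distr (src m n) (PiM {..<h} (\<lambda>_. std_normal)) (blk b i) = PiM {..<h} (\<lambda>_. std_normal)"
      unfolding src_def blk_def
      by (rule distr_PiM_reindex) (use b i off in \<open>auto simp: inj_on_def prob_space_std_normal\<close>)
    then have "(\<integral>\<^sup>+x. ennreal (q b i x) \<partial>src m n) = (\<integral>\<^sup>+x. ennreal (\<Sum>k<h. (x k - c (J x) k)\<^sup>2) \<partial>PiM {..<h} (\<lambda>_. std_normal))"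
      using nn_integral_distr[OF m1, of "\<lambda>x. ennreal (\<Sum>k<h. (x k - c (J x) k)\<^sup>2)"] m2 by (simp add: q_def)
    then show ?thesis using e by simp
  qed
  have dist: "ennreal (1 / real n) *
      (\<Sum>k<n. \<integral>\<^sup>+ x. ennreal ((x (k, i) - g i (f x) (restrict x (side m i n)) k)\<^sup>2) \<partial>src m n) \<le> ennreal d"
    if i: "i < m" for i
  proof -
    define r where "r k x = (x (k, i) - (if k < h then c (J (blk 0 i x)) k else c (J (blk o1 i x)) (k - o1)))\<^sup>2" for k x
    have r_m [measurable]: "r k \<in> borel_measurable (src m n)" if "k < n" for k
    proof -
      have [measurable]: "(\<lambda>x. x (k, i)) \<in> borel_measurable (src m n)"
        using measurable_component_singleton[of "(k, i)" "{..<n} \<times> {..<m}" "\<lambda>_. std_normal"] that i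
        unfolding measurable_cong_sets[OF refl sets_std_normal] src_def by simp
      have [measurable]: "(\<lambda>x. c (J (blk b i x)) l) \<in> borel_measurable (src m n)" if "b = 0 \<or> b = o1" for b l
        by (rule measurable_compose[OF Jsrc]) (use that i in auto)
      show ?thesis unfolding r_def by (cases "k < h") auto
    qed
    have q_m [measurable]: "q b i \<in> borel_measurable (src m n)" if b: "b = 0 \<or> b = o1" for b
    proof -
      have [measurable]: "(\<lambda>x. x (k + b, i)) \<in> borel_measurable (src m n)" if "k < h" for k
        using measurable_component_singleton[of "(k + b, i)" "{..<n} \<times> {..<m}" "\<lambda>_. std_normal"] off[OF b that] i
        unfolding measurable_cong_sets[OF refl sets_std_normal] src_def by simp
      have [measurable]: "(\<lambda>x. c (J (blk b i x)) l) \<in> borel_measurable (src m n)" for l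
        by (rule measurable_compose[OF Jsrc]) (use b i in auto)
      have "q b i = (\<lambda>x. \<Sum>k<h. (x (k + b, i) - c (J (blk b i x)) k)\<^sup>2)"
        unfolding q_def by (auto simp: blk_def fun_eq_iff)
      also have "\<dots> \<in> borel_measurable (src m n)" by measurable
      finally show ?thesis .
    qed
    have r_sum: "(\<Sum>k<n. r k x) \<le> q 0 i x + q o1 i x" for x
    proof -
      have "(\<Sum>k<n. r k x) = (\<Sum>k<h. r k x) + (\<Sum>k\<in>{h..<n}. r k x)"
        using h by (simp add: lessThan_atLeast0 sum.atLeastLessThan_concat)
      also have "(\<Sum>k<h. r k x) = q 0 i x"
        unfolding q_def r_def by (intro sum.cong) (auto simp: blk_def)
      also have "(\<Sum>k\<in>{h..<n}. r k x) = (\<Sum>k\<in>{h..<n}. (blk o1 i x (k - o1) - c (J (blk o1 i x)) (k - o1))\<^sup>2)"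
        unfolding r_def using h by (intro sum.cong) (auto simp: blk_def o1_def)
      also have "\<dots> = (\<Sum>k\<in>(\<lambda>k. k - o1) ` {h..<n}. (blk o1 i x k - c (J (blk o1 i x)) k)\<^sup>2)"
        using h by (subst sum.reindex) (auto simp: inj_on_def o1_def)
      \<comment> \<open>Times from h onwards use only part of the second block; instants in the
        overlap are served by the first block.\<close>
      also have "\<dots> \<le> q o1 i x"
        unfolding q_def using h by (intro sum_mono2) (auto simp: o1_def)
      finally show ?thesis by simp
    qed
    have "(\<Sum>k<n. \<integral>\<^sup>+ x. ennreal ((x (k, i) - g i (f x) (restrict x (side m i n)) k)\<^sup>2) \<partial>src m n)
        = (\<Sum>k<n. \<integral>\<^sup>+ x. ennreal (r k x) \<partial>src m n)"
      unfolding r_def g_eq[OF i] ..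
    also have "\<dots> = (\<integral>\<^sup>+ x. (\<Sum>k<n. ennreal (r k x)) \<partial>src m n)"
      by (subst nn_integral_sum) auto
    also have "\<dots> = (\<integral>\<^sup>+ x. ennreal (\<Sum>k<n. r k x) \<partial>src m n)"
      by (subst sum_ennreal) (auto simp: r_def)
    also have "\<dots> \<le> (\<integral>\<^sup>+ x. ennreal (q 0 i x + q o1 i x) \<partial>src m n)"
      by (intro nn_integral_mono ennreal_leI r_sum)
    also have "\<dots> = (\<integral>\<^sup>+ x. ennreal (q 0 i x) + ennreal (q o1 i x) \<partial>src m n)"
      by (intro nn_integral_cong ennreal_plus) (auto simp: q_def intro: sum_nonneg)
    also have "\<dots> = (\<integral>\<^sup>+ x. ennreal (q 0 i x) \<partial>src m n) + (\<integral>\<^sup>+ x. ennreal (q o1 i x) \<partial>src m n)"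
      by (intro nn_integral_add) auto
    also have "\<dots> \<le> ennreal \<delta> + ennreal \<delta>"
      using i by (intro add_mono q_le) auto
    also have "\<dots> = ennreal (2 * \<delta>)" using \<delta> by (simp flip: ennreal_plus)
    also have "\<dots> \<le> ennreal (n * d)" using \<delta> by (intro ennreal_leI)
    finally have "ennreal (1 / real n) * (\<Sum>k<n. \<integral>\<^sup>+ x. ennreal ((x (k, i) - g i (f x) (restrict x (side m i n)) k)\<^sup>2) \<partial>src m n)
      \<le> ennreal (1 / real n) * ennreal (n * d)"
      by (intro mult_left_mono) auto
    also have "\<dots> = ennreal d"
      using h by (simp add: ennreal_mult'[symmetric])
    finally show ?thesis .
  qed
  show ?thesis
    unfolding is_code_def
    by (intro exI[of _ f] exI[of _ g] conjI allI impI ballI f_m f_range g_m dist)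
qed

section \<open>Achievability, lower bound and the rate function\<close>

text \<open>Each of the m edge symbols costs one quantizer of length about n/2 at rate ln(1/D) / 2,
  which gives m/4 ln(1/D) per time instant.\<close>

lemma achievable_rate:
  assumes m: "m \<ge> 2" and D: "0 < D" "D \<le> 1"
  shows "achievable m D (real m / 4 * ln (1 / D))"
  unfolding achievable_def
proof (intro allI impI)
  fix \<epsilon> :: real assume \<epsilon>: "0 < \<epsilon>"
  define \<rho> where "\<rho> = ln (1 / D) / 2"
  have \<rho>: "0 \<le> \<rho>" using D by (simp add: \<rho>_def)
  \<comment> \<open>The first bound serves the distortion, the second the rate. Both leave strict
    slack for the factor 1 + 1/n caused by rounding h up.\<close>
  define \<epsilon>' where "\<epsilon>' = min (\<epsilon> / 2) (\<epsilon> / m)"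
  have \<epsilon>': "0 < \<epsilon>'" "\<epsilon>' \<le> \<epsilon> / 2" "m * \<epsilon>' \<le> \<epsilon>"
    using \<epsilon> m by (auto simp: \<epsilon>'_def min_def field_simps)
  have lim: "filterlim (\<lambda>n::nat. (n + 1) div 2) sequentially sequentially"
    unfolding filterlim_at_top
  proof
    fix Z :: nat
    show "\<forall>\<^sub>F n in sequentially. Z \<le> (n + 1) div 2"
      using eventually_ge_at_top[of "2 * Z"] by eventually_elim simp
  qed
  note quant = eventually_compose_filterlim[OF gaussian_quantizer[OF D \<epsilon>'(1)] lim]
  have "(\<lambda>n. (1 + 1 / real n) * (D + \<epsilon>')) \<longlonglongrightarrow> (1 + 0) * (D + \<epsilon>')"
    by (intro tendsto_intros lim_1_over_n)
  then have ev1: "\<forall>\<^sub>F n in sequentially. (1 + 1 / real n) * (D + \<epsilon>') < D + \<epsilon>"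
    using \<epsilon> \<epsilon>' by (intro order_tendstoD(2)[where y="(1 + 0) * (D + \<epsilon>')"]) auto
  have "(\<lambda>n. m / 2 * ((1 + 1 / real n) * (\<rho> + \<epsilon>'))) \<longlonglongrightarrow> m / 2 * ((1 + 0) * (\<rho> + \<epsilon>'))"
    by (intro tendsto_intros lim_1_over_n)
  moreover have "m / 2 * ((1 + 0) * (\<rho> + \<epsilon>')) < m / 2 * \<rho> + \<epsilon>"
    using \<epsilon>' \<epsilon> by (simp add: field_simps)
  ultimately have ev2: "\<forall>\<^sub>F n in sequentially. m / 2 * ((1 + 1 / real n) * (\<rho> + \<epsilon>')) < m / 2 * \<rho> + \<epsilon>"
    by (rule order_tendstoD(2))
  have "\<forall>\<^sub>F n in sequentially. \<exists>M::nat. M \<ge> 1 \<and> ln (real M) / real n \<le> real m / 4 * ln (1 / D) + \<epsilon> \<and> is_code m n M (D + \<epsilon>)"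
    using quant ev1 ev2 eventually_gt_at_top[of 0]
  proof eventually_elim
    case (elim n)
    define h where "h = (n + 1) div 2"
    have h: "h \<le> n" "n \<le> 2 * h" "2 * h \<le> n + 1" "0 < n" using elim(4) by (auto simp: h_def)
    from elim(1) obtain N J c where N: "1 \<le> N" and J: "J \<in> PiM {..<h} (\<lambda>_. std_normal) \<rightarrow>\<^sub>M count_space UNIV"
      "\<And>x. J x < N" and lnN: "ln (real N) \<le> h * (\<rho> + \<epsilon>')" and
      e: "(\<integral>\<^sup>+x. ennreal (\<Sum>k<h. (x k - c (J x) k)\<^sup>2) \<partial>PiM {..<h} (\<lambda>_. std_normal)) \<le> ennreal (h * (D + \<epsilon>'))"
      unfolding h_def[symmetric] \<rho>_def by blast
    have h2: "2 * real h \<le> real n + 1" using h(3) by linarith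
    have "is_code m n (N ^ m) (D + \<epsilon>)"
    proof (rule is_code_from_quantizer[OF m h(1,2,4) J e])
      show "0 \<le> h * (D + \<epsilon>')" using D \<epsilon>' by simp
      have "2 * (h * (D + \<epsilon>')) = (2 * real h) * (D + \<epsilon>')" by simp
      also have "\<dots> \<le> (real n + 1) * (D + \<epsilon>')" using h2 D \<epsilon>' by (intro mult_right_mono) auto
      also have "\<dots> = n * ((1 + 1 / real n) * (D + \<epsilon>'))" using h by (simp add: field_simps)
      also have "\<dots> \<le> n * (D + \<epsilon>)" using elim(2) by (intro mult_left_mono) auto
      finally show "2 * (h * (D + \<epsilon>')) \<le> n * (D + \<epsilon>)" .
    qed
    moreover have "ln (real (N ^ m)) / n \<le> real m / 4 * ln (1 / D) + \<epsilon>"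
    proof -
      have "ln (real (N ^ m)) = m * ln (real N)" using N by (simp add: ln_realpow)
      also have "\<dots> \<le> m * (h * (\<rho> + \<epsilon>'))" using lnN by (intro mult_left_mono) auto
      also have "\<dots> = m / 2 * ((2 * real h) * (\<rho> + \<epsilon>'))" by simp
      also have "\<dots> \<le> m / 2 * ((real n + 1) * (\<rho> + \<epsilon>'))"
        using h2 \<rho> \<epsilon>' by (intro mult_left_mono mult_right_mono) auto
      also have "\<dots> = n * (m / 2 * ((1 + 1 / real n) * (\<rho> + \<epsilon>')))" using h by (simp add: field_simps)
      also have "\<dots> \<le> n * (m / 2 * \<rho> + \<epsilon>)" using elim(3) by (intro mult_left_mono) auto
      finally show ?thesis using h by (simp add: field_simps \<rho>_def)
    qed
    ultimately show ?case using N by (intro exI[of _ "N ^ m"]) auto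
  qed
  then show "\<exists>N. \<forall>n\<ge>N. \<exists>M::nat. M \<ge> 1 \<and> ln (real M) / real n \<le> real m / 4 * ln (1 / D) + \<epsilon> \<and> is_code m n M (D + \<epsilon>)"
    by (simp add: eventually_sequentially)
qed

text \<open>A single blocklength per \<epsilon> suffices, as the converse is not asymptotic; then
  \<epsilon> tends to 0 and continuity of the logarithm at D > 0 finishes.\<close>

lemma achievable_lower_bound:
  assumes m: "m \<ge> 5" "odd m" and D: "0 < D" and R: "achievable m D R"
  shows "real m / 4 * ln (1 / D) \<le> R"
proof -
  have "real m / 4 * ln (1 / (D + \<epsilon>)) \<le> R + \<epsilon>" if \<epsilon>: "0 < \<epsilon>" for \<epsilon>
  proof -
    obtain N where N: "\<And>n. n \<ge> N \<Longrightarrow> \<exists>M::nat. M \<ge> 1 \<and> ln (real M) / real n \<le> R + \<epsilon> \<and> is_code m n M (D + \<epsilon>)"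
      using R \<epsilon> unfolding achievable_def by blast
    define n where "n = Suc N"
    obtain M :: nat where M: "ln (real M) / real n \<le> R + \<epsilon>" "is_code m n M (D + \<epsilon>)"
      using N[of n] by (auto simp: n_def)
    have "real m / 4 * ln (1 / (D + \<epsilon>)) * n \<le> ln M"
      using D \<epsilon> M by (intro is_code_bound[OF m]) (auto simp: n_def)
    then have "real m / 4 * ln (1 / (D + \<epsilon>)) \<le> ln M / n"
      by (simp add: n_def field_simps)
    with M show ?thesis by linarith
  qed
  then have "\<forall>\<^sub>F \<epsilon> in at_right 0. real m / 4 * ln (1 / (D + \<epsilon>)) \<le> R + \<epsilon>"
    by (auto simp: eventually_at_filter)
  moreover have "((\<lambda>\<epsilon>. real m / 4 * ln (1 / (D + \<epsilon>))) \<longlongrightarrow> real m / 4 * ln (1 / (D + 0))) (at_right 0)"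
    using D by (intro tendsto_intros) auto
  moreover have "((\<lambda>\<epsilon>. R + \<epsilon>) \<longlongrightarrow> R + 0) (at_right 0)"
    by (intro tendsto_intros)
  ultimately have "real m / 4 * ln (1 / (D + 0)) \<le> R + 0"
    by (intro tendsto_le[OF trivial_limit_at_right_real])
  then show ?thesis by simp
qed

theorem theorem11:
  fixes m :: nat and D :: real
  assumes "m \<ge> 5" and "odd m" and "0 < D" and "D \<le> 1"
  shows "R_IG m D = real m / 4 * ln (1 / D)"
  unfolding R_IG_def
\<comment> \<open>The infimum is attained because achievability already allows the slack \<epsilon>
  in rate and distortion.\<close>
proof (rule cInf_eq_minimum)
  show "real m / 4 * ln (1 / D) \<in> {R. achievable m D R}"
    using assms by (intro CollectI achievable_rate) auto
  show "real m / 4 * ln (1 / D) \<le> R" if "R \<in> {R. achievable m D R}" for R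
    using assms that by (intro achievable_lower_bound) auto
qed

end
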